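(* (1) (Strategic strong law of large numbers) For every $h\in[\underline{\mu},\overline{\mu}]$ and every $\gamma\in[0,1]$ with $h=\gamma\overline{\mu}+(1-\gamma)\underline{\mu}$, the admissible strategy $\theta^{\gamma}$ described in the context satisfies $$\lim_{n\to\infty}\frac{S_n^{\theta^{\gamma}}}{n}=h\quad P\text{-a.s.}$$ (2) (Weak law of large numbers) For every $\varepsilon>0$, $$\lim_{n\to\infty}\inf_{\theta\in\Theta}P\left(\underline{\mu}-\varepsilon<\frac{S_n^{\theta}}{n}<\overline{\mu}+\varepsilon\right)=1,$$ and for every $\varepsilon>0$ and every $h\in[\underline{\mu},\overline{\mu}]$, $$\lim_{n\to\infty}\sup_{\theta\in\Theta}P\left(\left|\frac{S_n^{\theta}}{n}-h\right|<\varepsilon\right)=1.$$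
   Context: Setting (two-armed bandit). Let $(\Omega,\mathcal{F},P)$ be a probability space and $W^L,W^R$ real random variables with finite means $\mu_L,\mu_R$ and finite variances $\sigma_L^2,\sigma_R^2$. Let $\{W_i^L\}_{i\ge1}$ and $\{W_i^R\}_{i\ge1}$ be sequences of i.i.d. copies of $W^L$ and $W^R$ respectively, the two sequences being independent of each other. Put $\overline{\mu}=\max\{\mu_L,\mu_R\}$, $\underline{\mu}=\min\{\mu_L,\mu_R\}$. A sampling strategy is a sequence $\theta=(\vartheta_1,\vartheta_2,\dots)$ of $\{1,2\}$-valued random variables; the reward at round $i$ is $Z_i^{\theta}=W_i^L$ if $\vartheta_i=1$ and $Z_i^\theta=W_i^R$ if $\vartheta_i=2$. Let $\mathcal{H}_n^{\theta}=\sigma\{Z_1^{\theta},\dots,Z_n^{\theta}\}$, $\mathcal{H}_0^{\theta}=\{\emptyset,\Omega\}$. The strategy $\theta$ is admissible if $\vartheta_n$ is $\mathcal{H}_{n-1}^{\theta}$-measurable for all $n\ge1$; $\Theta$ is the set of all admissible strategies. Put $S_n^{\theta}=\sum_{i=1}^nZ_i^{\theta}$. The strategy $\theta^{\gamma}=(\vartheta_1^\gamma,\vartheta_2^\gamma,\dots)$, $\gamma\in[0,1]$ (its definition does not use the values $\mu_L,\mu_R$). Set $\vartheta_1^{\gamma}=1$, $\vartheta_2^{\gamma}=2$. For $k\ge1$ let $m_k^L$ (resp. $m_k^R$) be the number of indices $j\le k$ with $\vartheta_j^{\gamma}=1$ (resp. $\vartheta_j^\gamma=2$), and, when these counts are positive,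 let $$\mu_k^L=\frac{1}{m_k^L}\sum_{j\le k,\ \vartheta_j^{\gamma}=1}W_j^L,\qquad \mu_k^R=\frac{1}{m_k^R}\sum_{j\le k,\ \vartheta_j^{\gamma}=2}W_j^R .$$ For $k\ge3$: if $k=2^i-1$ for some integer $i>1$, set $\vartheta_k^{\gamma}=1$; if $k=2^i$ for some integer $i>1$, set $\vartheta_k^{\gamma}=2$; if $2^i<k<2^{i+1}-1$ for some integer $i>1$, then: - if $\mu_{k-1}^L\ge\mu_{k-1}^R$, set $\vartheta_k^{\gamma}=1$ when $\frac{m_{k-1}^L}{k-1}<\gamma$ and $\vartheta_k^{\gamma}=2$ when $\frac{m_{k-1}^L}{k-1}\ge\gamma$; - if $\mu_{k-1}^L<\mu_{k-1}^R$, set $\vartheta_k^{\gamma}=2$ when $\frac{m_{k-1}^R}{k-1}<\gamma$ and $\vartheta_k^{\gamma}=1$ when $\frac{m_{k-1}^R}{k-1}\ge\gamma$. *)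

theory Defs
  imports "HOL-Probability.Probability"
begin

text \<open>
  Rounds are numbered from 1; the values at index 0 of reward sequences and of strategies are
  never used. Arm 1 is the left arm, arm 2 the right arm.
\<close>

definition reward ::
  "(nat \<Rightarrow> 'a \<Rightarrow> real) \<Rightarrow> (nat \<Rightarrow> 'a \<Rightarrow> real) \<Rightarrow> (nat \<Rightarrow> 'a \<Rightarrow> nat) \<Rightarrow> nat \<Rightarrow> 'a \<Rightarrow> real"
  where "reward WL WR \<theta> i \<omega> = (if \<theta> i \<omega> = 1 then WL i \<omega> else WR i \<omega>)"

definition total_reward ::
  "(nat \<Rightarrow> 'a \<Rightarrow> real) \<Rightarrow> (nat \<Rightarrow> 'a \<Rightarrow> real) \<Rightarrow> (nat \<Rightarrow> 'a \<Rightarrow> nat) \<Rightarrow> nat \<Rightarrow> 'a \<Rightarrow> real"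
  where "total_reward WL WR \<theta> n \<omega> = (\<Sum>i=1..n. reward WL WR \<theta> i \<omega>)"

definition history ::
  "'a measure \<Rightarrow> (nat \<Rightarrow> 'a \<Rightarrow> real) \<Rightarrow> (nat \<Rightarrow> 'a \<Rightarrow> real) \<Rightarrow> (nat \<Rightarrow> 'a \<Rightarrow> nat) \<Rightarrow> nat \<Rightarrow> 'a measure"
  where "history M WL WR \<theta> n =
    sigma (space M) {reward WL WR \<theta> i -` A \<inter> space M | i A. i \<in> {1..n} \<and> A \<in> sets borel}"

definition sampling_strategy :: "'a measure \<Rightarrow> (nat \<Rightarrow> 'a \<Rightarrow> nat) \<Rightarrow> bool"
  where "sampling_strategy M \<theta> \<longleftrightarrow> (\<forall>n\<ge>1. \<theta> n \<in> M \<rightarrow>\<^sub>M count_space {1, 2})"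

definition admissible_strategies ::
  "'a measure \<Rightarrow> (nat \<Rightarrow> 'a \<Rightarrow> real) \<Rightarrow> (nat \<Rightarrow> 'a \<Rightarrow> real) \<Rightarrow> (nat \<Rightarrow> 'a \<Rightarrow> nat) set"
  where "admissible_strategies M WL WR =
    {\<theta>. sampling_strategy M \<theta> \<and>
        (\<forall>n\<ge>1. \<theta> n \<in> history M WL WR \<theta> (n - 1) \<rightarrow>\<^sub>M count_space {1, 2})}"

text \<open>
  The strategy \<open>\<theta>\<^sup>\<gamma>\<close> is defined path by path: \<open>v\<close> is the sequence of arms chosen so far,
  \<open>wL\<close> and \<open>wR\<close> are realised reward sequences.
\<close>

definition pulls :: "(nat \<Rightarrow> nat) \<Rightarrow> nat \<Rightarrow> nat \<Rightarrow> nat"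
  where "pulls v a k = card {j \<in> {1..k}. v j = a}"

definition arm_mean :: "(nat \<Rightarrow> real) \<Rightarrow> (nat \<Rightarrow> nat) \<Rightarrow> nat \<Rightarrow> nat \<Rightarrow> real"
  where "arm_mean w v a k = (\<Sum>j \<in> {j \<in> {1..k}. v j = a}. w j) / real (pulls v a k)"

text \<open>
  For \<open>k \<ge> 3\<close> the last branch is reached exactly when \<open>2 ^ i < k < 2 ^ (i + 1) - 1\<close> for some
  \<open>i > 1\<close>. The value at \<open>k = 0\<close> is a dummy.
\<close>

definition gamma_rule ::
  "real \<Rightarrow> (nat \<Rightarrow> real) \<Rightarrow> (nat \<Rightarrow> real) \<Rightarrow> (nat \<Rightarrow> nat) \<Rightarrow> nat \<Rightarrow> nat"
  where "gamma_rule \<gamma> wL wR v k =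
    (if k \<le> 1 then 1
     else if k = 2 then 2
     else if \<exists>i>1. k = 2 ^ i - 1 then 1
     else if \<exists>i>1. k = 2 ^ i then 2
     else if arm_mean wL v 1 (k - 1) \<ge> arm_mean wR v 2 (k - 1)
       then (if real (pulls v 1 (k - 1)) / real (k - 1) < \<gamma> then 1 else 2)
       else (if real (pulls v 2 (k - 1)) / real (k - 1) < \<gamma> then 2 else 1))"

text \<open>
  \<open>gamma_rule \<dots> v k\<close> looks at \<open>v\<close> only at indices below \<open>k\<close>; the truncation of \<open>v\<close> makes the
  recursion visibly well-founded and is removed again in \<open>gamma_path_rec\<close>.
\<close>

fun gamma_path :: "real \<Rightarrow> (nat \<Rightarrow> real) \<Rightarrow> (nat \<Rightarrow> real) \<Rightarrow> nat \<Rightarrow> nat"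
  where "gamma_path \<gamma> wL wR k =
    gamma_rule \<gamma> wL wR (\<lambda>j. if j < k then gamma_path \<gamma> wL wR j else 0) k"

declare gamma_path.simps [simp del]

definition gamma_strategy ::
  "(nat \<Rightarrow> 'a \<Rightarrow> real) \<Rightarrow> (nat \<Rightarrow> 'a \<Rightarrow> real) \<Rightarrow> real \<Rightarrow> nat \<Rightarrow> 'a \<Rightarrow> nat"
  where "gamma_strategy WL WR \<gamma> k \<omega> = gamma_path \<gamma> (\<lambda>i. WL i \<omega>) (\<lambda>i. WR i \<omega>) k"

lemma gamma_rule_cong:
  assumes "\<And>j. 1 \<le> j \<Longrightarrow> j < k \<Longrightarrow> v j = v' j"
  shows "gamma_rule \<gamma> wL wR v k = gamma_rule \<gamma> wL wR v' k"
proof (cases "k \<le> 1")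
  case True
  then show ?thesis by (simp add: gamma_rule_def)
next
  case False
  have eq: "{j \<in> {1..k - 1}. v j = a} = {j \<in> {1..k - 1}. v' j = a}" for a
    using assms False by auto
  show ?thesis
    unfolding gamma_rule_def arm_mean_def pulls_def eq ..
qed

lemma gamma_path_rec:
  "gamma_path \<gamma> wL wR k = gamma_rule \<gamma> wL wR (gamma_path \<gamma> wL wR) k"
  by (subst gamma_path.simps) (rule gamma_rule_cong, simp)

lemma gamma_rule_last_branch:
  fixes k :: nat
  assumes "k \<ge> 3"
  shows "(\<nexists>i. i > 1 \<and> k = 2 ^ i - 1) \<and> (\<nexists>i. i > 1 \<and> k = 2 ^ i) \<longleftrightarrow>
    (\<exists>i>1. 2 ^ i < k \<and> k < 2 ^ (i + 1) - 1)"
    (is "?L \<longleftrightarrow> ?R")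
proof
  assume L: ?L
  obtain i where i: "2 ^ i \<le> k" "k < 2 ^ (i + 1)"
    using ex_power_ivl1[of 2 k] assms by auto
  have "i \<noteq> 0" using i assms by (intro notI) simp
  have k3: "k \<noteq> 3" using L by (auto dest!: spec[of _ 2])
  have "i \<noteq> 1" using i assms k3 by (intro notI) simp
  with \<open>i \<noteq> 0\<close> have i1: "i > 1" by simp
  have "k \<noteq> 2 ^ i" "k \<noteq> 2 ^ (i + 1) - 1"
    using L i1 by (auto dest: spec[of _ i] spec[of _ "i + 1"])
  with i i1 show ?R by (intro exI[of _ i]) linarith
next
  assume ?R
  then obtain i where i: "i > 1" "2 ^ i < k" "k < 2 ^ (i + 1) - 1" by auto
  have "k + 1 \<noteq> 2 ^ j \<and> k \<noteq> 2 ^ j" for j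
  proof (cases "j \<le> i")
    case True
    then have "(2::nat) ^ j \<le> 2 ^ i" by simp
    with i show ?thesis by linarith
  next
    case False
    then have "(2::nat) ^ (i + 1) \<le> 2 ^ j" by (intro power_increasing) auto
    with i show ?thesis by linarith
  qed
  then show ?L by (metis Suc_eq_plus1 Suc_pred' pos2 zero_less_power)
qed

end

theory Submission
  imports Defs "HOL-Real_Asymp.Real_Asymp"
begin

text \<open>
  For an admissible strategy the centred reward of the arm pulled at round \<open>j\<close> is independent of
  the past that decided to pull it, so predictable combinations of centred rewards are orthogonal.
  The weak law is then Chebyshev's inequality with a bound uniform in the strategy. For the
  strong law let \<open>Y k\<close> be the centred reward of the \<open>k\<close>-th pull of a fixed arm. The \<open>Y k\<close> are
  orthogonal with bounded second moments, so their averages vanish almost surely, whatever the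
  random times of the pulls; the forced pulls make both counts unbounded, so both empirical means
  are consistent. From some round on the strategy \<open>\<theta>\<^sup>\<gamma>\<close> thus knows the better arm and steers its
  frequency to \<open>\<gamma>\<close>, up to the logarithmically many forced pulls.
\<close>

section \<open>Strong law for orthogonal sequences\<close>

text \<open>Orthogonality of the \<open>Y k\<close> comes from an isometry for predictable sums: the
  coefficients are the indicators of "the \<open>k\<close>-th pull happens at round
  \<open>j\<close>", and for distinct \<open>k\<close> they never overlap. Pulls happen at random
  times, so \<open>Y k\<close> would be an infinite series; the forced pulls bound the time of the
  \<open>k\<close>-th pull by the deterministic number \<open>2 ^ k\<close> and make it a finite
  sum. Admissibility refers to a history that depends on the strategy. It is replaced by one larger
  filtration holding the rewards of both arms, observed or not, so that the same independence
  statement serves every strategy. If the two means coincide there is no better arm to recognise.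
  The average reward then converges because it is a convex combination of two empirical means with a
  common limit. The supremum in the weak law is handled by a single strategy: \<open>h\<close>
  determines a suitable \<open>\<gamma>\<close>, and the strong law for
  \<open>\<theta>\<^sup>\<gamma>\<close> yields convergence in probability.\<close>

lemma AE_tendsto_0_if_summable_integrals:
  fixes f :: "nat \<Rightarrow> 'a \<Rightarrow> real"
  assumes int: "\<And>n. integrable M (f n)" and nonneg: "\<And>n x. 0 \<le> f n x"
    and summ: "summable (\<lambda>n. \<integral>x. f n x \<partial>M)"
  shows "AE x in M. (\<lambda>n. f n x) \<longlonglongrightarrow> 0"
proof -
  have [measurable]: "f n \<in> borel_measurable M" for n
    using int[of n] by simp
  have "(\<integral>\<^sup>+x. (\<Sum>n. ennreal (f n x)) \<partial>M) = (\<Sum>n. \<integral>\<^sup>+x. ennreal (f n x) \<partial>M)"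
    by (rule nn_integral_suminf) simp
  also have "\<dots> = (\<Sum>n. ennreal (\<integral>x. f n x \<partial>M))"
    by (simp add: nn_integral_eq_integral int nonneg)
  also have "\<dots> = ennreal (\<Sum>n. \<integral>x. f n x \<partial>M)"
    by (rule suminf_ennreal2) (simp_all add: nonneg summ)
  finally have "(\<integral>\<^sup>+x. (\<Sum>n. ennreal (f n x)) \<partial>M) \<noteq> \<infinity>"
    by simp
  then have "AE x in M. (\<Sum>n. ennreal (f n x)) \<noteq> \<infinity>"
    by (intro nn_integral_PInf_AE) simp_all
  then show ?thesis
  proof eventually_elim
    case (elim x)
    then have "summable (\<lambda>n. f n x)"
      by (intro summable_suminf_not_top) (simp_all add: nonneg)
    then show ?case by (rule summable_LIMSEQ_zero)
  qed
qed

lemma integrable_mult_of_squares: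
  fixes f g :: "'a \<Rightarrow> real"
  assumes [measurable]: "f \<in> borel_measurable M" "g \<in> borel_measurable M"
    and "integrable M (\<lambda>x. (f x)\<^sup>2)" "integrable M (\<lambda>x. (g x)\<^sup>2)"
  shows "integrable M (\<lambda>x. f x * g x)"
proof (rule Bochner_Integration.integrable_bound)
  show "integrable M (\<lambda>x. (f x)\<^sup>2 + (g x)\<^sup>2)"
    using assms by simp
  have "\<bar>a * b\<bar> \<le> a\<^sup>2 + b\<^sup>2" for a b :: real
    using sum_squares_bound[of "\<bar>a\<bar>" "\<bar>b\<bar>"] zero_le_mult_iff[of "\<bar>a\<bar>" "\<bar>b\<bar>"]
    unfolding abs_mult power2_abs by linarith
  then show "AE x in M. norm (f x * g x) \<le> norm ((f x)\<^sup>2 + (g x)\<^sup>2)"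
    by simp
qed simp

text \<open>Second moments of the partial sums grow at most linearly, so along the squares the
  averages have summable second moments. Fewer than \<open>2 * n + 1\<close> terms lie strictly
  between \<open>n\<^sup>2\<close> and the next square, few enough for Cauchy-Schwarz to replace a
  maximal inequality.\<close>

lemma strong_law_orthogonal:
  fixes Y :: "nat \<Rightarrow> 'a \<Rightarrow> real"
  assumes meas [measurable]: "\<And>k. Y k \<in> borel_measurable M"
    and sq: "\<And>k. integrable M (\<lambda>x. (Y k x)\<^sup>2)"
    and C: "\<And>k. (\<integral>x. (Y k x)\<^sup>2 \<partial>M) \<le> C"
    and orth: "\<And>k l. k \<noteq> l \<Longrightarrow> (\<integral>x. Y k x * Y l x \<partial>M) = 0"
  shows "AE x in M. (\<lambda>n. (\<Sum>k=1..n. Y k x) / real n) \<longlonglongrightarrow> 0"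
proof -
  define T where "T n x = (\<Sum>k=1..n. Y k x)" for n x
  \<comment> \<open>The block ends at \<open>(n + 1)\<^sup>2 - 1\<close>, the last index before the
    next square.\<close>
  define V where "V n x = (\<Sum>k=n\<^sup>2+1..n\<^sup>2+2*n. (Y k x)\<^sup>2)" for n x
  \<comment> \<open>Dominates \<open>(T m x / m)\<^sup>2 / 2\<close> for all \<open>m\<close> between two consecutive squares.\<close>
  define Q where "Q n x = ((T (n\<^sup>2) x)\<^sup>2 + 2 * real n * V n x) / real n ^ 4" for n x
  have prod: "integrable M (\<lambda>x. Y k x * Y l x)" for k l
    by (intro integrable_mult_of_squares sq meas)
  have T2: "(T n x)\<^sup>2 = (\<Sum>k=1..n. \<Sum>l=1..n. Y k x * Y l x)" for n x
    by (simp add: T_def power2_eq_square sum_product)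
  have intT: "integrable M (\<lambda>x. (T n x)\<^sup>2)" for n
    unfolding T2 by (intro Bochner_Integration.integrable_sum prod)
  have ET: "(\<integral>x. (T n x)\<^sup>2 \<partial>M) \<le> real n * C" for n
  proof -
    have "(\<integral>x. (T n x)\<^sup>2 \<partial>M) = (\<Sum>k=1..n. \<Sum>l=1..n. \<integral>x. Y k x * Y l x \<partial>M)"
      unfolding T2 by (simp add: Bochner_Integration.integral_sum prod Bochner_Integration.integrable_sum)
    also have "\<dots> = (\<Sum>k=1..n. \<Sum>l=1..n. if k = l then \<integral>x. (Y k x)\<^sup>2 \<partial>M else 0)"
      by (intro sum.cong refl) (simp add: orth power2_eq_square)
    also have "\<dots> = (\<Sum>k=1..n. \<integral>x. (Y k x)\<^sup>2 \<partial>M)"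
      by (intro sum.cong) simp_all
    also have "\<dots> \<le> (\<Sum>k=1..n. C)"
      by (intro sum_mono C)
    finally show ?thesis by simp
  qed
  have intV: "integrable M (V n)" for n
    unfolding V_def by (intro Bochner_Integration.integrable_sum sq)
  have EV: "(\<integral>x. V n x \<partial>M) \<le> 2 * real n * C" for n
  proof -
    have "(\<integral>x. V n x \<partial>M) = (\<Sum>k=n\<^sup>2+1..n\<^sup>2+2*n. \<integral>x. (Y k x)\<^sup>2 \<partial>M)"
      unfolding V_def by (intro Bochner_Integration.integral_sum sq)
    also have "\<dots> \<le> (\<Sum>k=n\<^sup>2+1..n\<^sup>2+2*n. C)"
      by (intro sum_mono C)
    finally show ?thesis by simp
  qed
  have Vnn: "0 \<le> V n x" for n x
    unfolding V_def by (intro sum_nonneg) simp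
  have Qnn: "0 \<le> Q n x" for n x
    unfolding Q_def using Vnn by simp
  have intQ: "integrable M (Q n)" for n
    unfolding Q_def using intT intV by simp
  \<comment> \<open>The factor 5 collects \<open>n\<^sup>2 * C\<close> from \<open>T\<close> and
    \<open>4 * n\<^sup>2 * C\<close> from \<open>V\<close>. At \<open>n = 0\<close> both sides are
    0, since division by zero gives 0.\<close>
  have EQ: "(\<integral>x. Q n x \<partial>M) \<le> 5 * C * (1 / real n ^ 2)" for n
  proof -
    have "(\<integral>x. Q n x \<partial>M) = ((\<integral>x. (T (n\<^sup>2) x)\<^sup>2 \<partial>M) + 2 * real n * (\<integral>x. V n x \<partial>M)) / real n ^ 4"
      unfolding Q_def using intT intV by simp
    also have "\<dots> \<le> (real (n\<^sup>2) * C + 2 * real n * (2 * real n * C)) / real n ^ 4"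
      by (intro divide_right_mono add_mono mult_left_mono ET EV) auto
    also have "\<dots> = 5 * C * (1 / real n ^ 2)"
      by (cases "n = 0") (simp_all add: field_simps power2_eq_square power4_eq_xxxx)
    finally show ?thesis .
  qed
  have "summable (\<lambda>n. \<integral>x. Q n x \<partial>M)"
  proof (rule summable_comparison_test'[where N = 0])
    show "summable (\<lambda>n. 5 * C * (1 / real n ^ 2))"
      using inverse_power_summable[of 2, where 'a = real]
      by (intro summable_mult) (simp add: inverse_eq_divide)
    show "norm (\<integral>x. Q n x \<partial>M) \<le> 5 * C * (1 / real n ^ 2)" for n
      using EQ[of n] by (simp add: Qnn)
  qed
  then have "AE x in M. (\<lambda>n. Q n x) \<longlonglongrightarrow> 0"
    by (intro AE_tendsto_0_if_summable_integrals intQ Qnn)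
  then show ?thesis
  proof eventually_elim
    case (elim x)
    \<comment> \<open>\<open>(r m)\<^sup>2\<close> is the last square not above \<open>m\<close>;
      the bound known along squares is used at index \<open>r m\<close>.\<close>
    define r where "r m = nat \<lfloor>sqrt (real m)\<rfloor>" for m
    have r: "(r m)\<^sup>2 \<le> m" "m \<le> (r m)\<^sup>2 + 2 * r m" for m
    proof -
      have 1: "real (r m) \<le> sqrt (real m)" "sqrt (real m) < real (r m) + 1"
        unfolding r_def by (auto simp: of_nat_floor)
      have "real (r m) ^ 2 \<le> sqrt (real m) ^ 2" "sqrt (real m) ^ 2 < (real (r m) + 1) ^ 2"
        using 1 by (intro power_mono power_strict_mono; simp)+
      then have "real ((r m)\<^sup>2) \<le> real m" "real m < real ((r m + 1)\<^sup>2)"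
        by (simp_all add: algebra_simps)
      then have "(r m)\<^sup>2 \<le> m" "m < (r m + 1)\<^sup>2"
        by (simp_all only: of_nat_le_iff of_nat_less_iff)
      then show "(r m)\<^sup>2 \<le> m" "m \<le> (r m)\<^sup>2 + 2 * r m"
        by (simp_all add: power2_eq_square)
    qed
    have lim_r: "filterlim r at_top sequentially"
    proof -
      have "filterlim (\<lambda>m. sqrt (real m)) at_top sequentially"
        by (rule filterlim_compose[OF sqrt_at_top filterlim_real_sequentially])
      then show ?thesis
        unfolding r_def
        by (intro filterlim_compose[OF filterlim_nat_sequentially]
            filterlim_compose[OF filterlim_floor_sequentially])
    qed
    have bound: "(T m x / real m)\<^sup>2 \<le> 2 * Q (r m) x" for m
    proof (cases "m = 0")
      case True
      then show ?thesis by (simp add: Qnn)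
    next
      case False
      define n where "n = r m"
      have n: "n\<^sup>2 \<le> m" "m \<le> n\<^sup>2 + 2 * n"
        using r[of m] by (simp_all add: n_def)
      have n0: "n > 0" using n False by (cases "n = 0") auto
      define B where "B = (\<Sum>k=n\<^sup>2+1..m. Y k x)"
      have TB: "T m x = T (n\<^sup>2) x + B"
        using sum.ub_add_nat[of 1 "n\<^sup>2" "\<lambda>k. Y k x" "m - n\<^sup>2"] n(1) by (simp add: T_def B_def)
      \<comment> \<open>Cauchy-Schwarz against the constant 1.\<close>
      have "B\<^sup>2 \<le> real (card {n\<^sup>2+1..m}) * (\<Sum>k=n\<^sup>2+1..m. (Y k x)\<^sup>2)"
        using sum_squared_le_sum_of_squares[of "\<lambda>k. Y k x" "{n\<^sup>2+1..m}"]
        by (simp add: B_def mult.commute)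
      also have "\<dots> \<le> (2 * real n) * V n x"
      proof (rule mult_mono)
        have "card {n\<^sup>2+1..m} \<le> 2 * n" using n by simp
        then show "real (card {n\<^sup>2+1..m}) \<le> 2 * real n"
          by (metis of_nat_le_iff of_nat_mult of_nat_numeral)
        show "(\<Sum>k=n\<^sup>2+1..m. (Y k x)\<^sup>2) \<le> V n x"
          unfolding V_def using n by (intro sum_mono2) auto
      qed (auto intro: sum_nonneg)
      finally have B2: "B\<^sup>2 \<le> 2 * real n * V n x" .
      \<comment> \<open>A square of a sum is at most twice the sum of the squares; this is the 2 in
        front of \<open>Q\<close> in \<open>bound\<close>.\<close>
      have "(T m x)\<^sup>2 \<le> 2 * (T (n\<^sup>2) x)\<^sup>2 + 2 * B\<^sup>2"
        unfolding TB using sum_squares_bound[of "T (n\<^sup>2) x" B] by (simp add: power2_sum)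
      also have "\<dots> \<le> 2 * ((T (n\<^sup>2) x)\<^sup>2 + 2 * real n * V n x)"
        using B2 by simp
      finally have T: "(T m x)\<^sup>2 \<le> 2 * ((T (n\<^sup>2) x)\<^sup>2 + 2 * real n * V n x)" .
      have "real n ^ 4 = (real (n\<^sup>2))\<^sup>2" by simp
      also have "\<dots> \<le> (real m)\<^sup>2" using n(1) by (intro power_mono) (simp_all only: of_nat_le_iff of_nat_0_le_iff)
      finally have nm: "real n ^ 4 \<le> (real m)\<^sup>2" .
      have "(T m x / real m)\<^sup>2 = (T m x)\<^sup>2 / (real m)\<^sup>2"
        by (simp add: power_divide)
      also have "\<dots> \<le> (2 * ((T (n\<^sup>2) x)\<^sup>2 + 2 * real n * V n x)) / real n ^ 4"
        using T nm n0 Vnn[of n x] by (intro frac_le) auto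
      finally show ?thesis by (simp add: Q_def n_def)
    qed
    have "(\<lambda>m. 2 * Q (r m) x) \<longlonglongrightarrow> 0"
      using tendsto_mult_right_zero[OF filterlim_compose[OF elim lim_r], of 2] .
    then have "(\<lambda>m. (T m x / real m)\<^sup>2) \<longlonglongrightarrow> 0"
      by (rule tendsto_sandwich[OF _ _ tendsto_const, rotated 2]) (auto simp: bound)
    then have "(\<lambda>m. T m x / real m) \<longlonglongrightarrow> 0"
      by (simp)
    then show ?case by (simp add: T_def)
  qed
qed

section \<open>Predictable sums of independent noise\<close>

text \<open>A martingale difference sequence in a strong sense: \<open>\<xi> n\<close> is
  independent of \<open>F (n - 1)\<close>, not merely conditionally centred. Independence is phrased
  through an arbitrary real predictable \<open>g\<close>, because it gets applied to products of
  past noise and coefficients. The two arms are two instances over the same filtration.\<close>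

locale noise = prob_space M for M :: "'a measure" +
  fixes F :: "nat \<Rightarrow> 'a measure" and \<xi> :: "nat \<Rightarrow> 'a \<Rightarrow> real" and v :: real
  assumes F_sub: "\<And>n. subalgebra M (F n)"
    and F_mono: "\<And>m n. m \<le> n \<Longrightarrow> sets (F m) \<subseteq> sets (F n)"
    and adapted: "\<And>n. 1 \<le> n \<Longrightarrow> \<xi> n \<in> borel_measurable (F n)"
    and indep: "\<And>n g. 1 \<le> n \<Longrightarrow> g \<in> borel_measurable (F (n - 1)) \<Longrightarrow> indep_var borel (\<xi> n) borel g"
    and square_integrable: "\<And>n. 1 \<le> n \<Longrightarrow> integrable M (\<lambda>x. (\<xi> n x)\<^sup>2)"
    and mean_zero: "\<And>n. 1 \<le> n \<Longrightarrow> expectation (\<xi> n) = 0"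
    and variance: "\<And>n. 1 \<le> n \<Longrightarrow> expectation (\<lambda>x. (\<xi> n x)\<^sup>2) = v"
begin

lemma measurable_F_mono:
  "g \<in> measurable (F m) N \<Longrightarrow> m \<le> n \<Longrightarrow> g \<in> measurable (F n) N"
  using F_sub[of m] F_sub[of n] F_mono[of m n]
  by (auto simp: measurable_def subalgebra_def)

lemma measurable_F_M: "g \<in> measurable (F m) N \<Longrightarrow> g \<in> measurable M N"
  using F_sub[of m] by (rule measurable_from_subalg)

lemma noise_measurable: "1 \<le> n \<Longrightarrow> \<xi> n \<in> borel_measurable M"
  by (rule measurable_F_M[OF adapted])

lemma noise_integrable: "1 \<le> n \<Longrightarrow> integrable M (\<xi> n)"
  using square_integrable_imp_integrable[OF noise_measurable square_integrable] by simp

text \<open>A discrete Ito isometry in polarised form. Off the diagonal the later noise is centred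
  and independent of the remaining factors, all known one round earlier; on the diagonal
  \<open>(\<xi> j)\<^sup>2\<close> is independent of the coefficients. The lengths \<open>m\<close>
  and \<open>n\<close> differ because the sums belonging to different pulls are cut at different
  times.\<close>

lemma
  fixes c d :: "nat \<Rightarrow> 'a \<Rightarrow> real"
  assumes c: "\<And>j. 1 \<le> j \<Longrightarrow> c j \<in> borel_measurable (F (j - 1))"
    and d: "\<And>j. 1 \<le> j \<Longrightarrow> d j \<in> borel_measurable (F (j - 1))"
    and c1: "\<And>j x. \<bar>c j x\<bar> \<le> 1" and d1: "\<And>j x. \<bar>d j x\<bar> \<le> 1"
  shows predictable_sums_integrable:
      "integrable M (\<lambda>x. (\<Sum>i=1..m. c i x * \<xi> i x) * (\<Sum>j=1..n. d j x * \<xi> j x))"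
    and predictable_sums_isometry:
      "expectation (\<lambda>x. (\<Sum>i=1..m. c i x * \<xi> i x) * (\<Sum>j=1..n. d j x * \<xi> j x)) =
        v * (\<Sum>j=1..min m n. expectation (\<lambda>x. c j x * d j x))"
proof -
  have prod: "(\<Sum>i=1..m. c i x * \<xi> i x) * (\<Sum>j=1..n. d j x * \<xi> j x) =
      (\<Sum>i=1..m. \<Sum>j=1..n. (c i x * \<xi> i x) * (d j x * \<xi> j x))" for x
    by (simp add: sum_product)
  note [measurable] = measurable_F_M[OF c] measurable_F_M[OF d] noise_measurable
  have sq: "integrable M (\<lambda>x. (a x * \<xi> j x)\<^sup>2)"
    if "1 \<le> j" and a_meas: "a \<in> borel_measurable M" and a: "\<And>x. \<bar>a x\<bar> \<le> 1" for a j
  proof (rule Bochner_Integration.integrable_bound[OF square_integrable[OF \<open>1 \<le> j\<close>]])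
    show "AE x in M. norm ((a x * \<xi> j x)\<^sup>2) \<le> norm ((\<xi> j x)\<^sup>2)"
      using a by (auto simp: power_mult_distrib abs_square_le_1 intro!: mult_left_le_one_le)
  qed (use a_meas noise_measurable[OF \<open>1 \<le> j\<close>] in measurable)
  have int: "integrable M (\<lambda>x. (c i x * \<xi> i x) * (d j x * \<xi> j x))" if "1 \<le> i" "1 \<le> j" for i j
    using that by (intro integrable_mult_of_squares sq c1 d1) simp_all
  show "integrable M (\<lambda>x. (\<Sum>i=1..m. c i x * \<xi> i x) * (\<Sum>j=1..n. d j x * \<xi> j x))"
    unfolding prod by (intro Bochner_Integration.integrable_sum int) auto
  \<comment> \<open>Stated for arbitrary \<open>a\<close> and \<open>b\<close>, so that exchanging
    the roles of \<open>c\<close> and \<open>d\<close> also covers the half of the double sum with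
    \<open>j < i\<close>.\<close>
  have zero: "expectation (\<lambda>x. (a x * \<xi> i x) * (b x * \<xi> j x)) = 0"
    if ij: "1 \<le> i" "i < j" and a: "a \<in> borel_measurable (F (i - 1))" "\<And>x. \<bar>a x\<bar> \<le> 1"
      and b: "b \<in> borel_measurable (F (j - 1))" "\<And>x. \<bar>b x\<bar> \<le> 1"
    for i j and a b :: "'a \<Rightarrow> real"
  proof -
    have "a \<in> borel_measurable (F (j - 1))" "\<xi> i \<in> borel_measurable (F (j - 1))"
      using ij a by (auto intro: measurable_F_mono[OF adapted] measurable_F_mono[OF a(1)])
    let ?g = "\<lambda>x. a x * \<xi> i x * b x"
    have g: "?g \<in> borel_measurable (F (j - 1))"
      by (intro borel_measurable_times) fact+
    have "integrable M ?g"
    proof (rule Bochner_Integration.integrable_bound[OF noise_integrable[OF ij(1)]])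
      show "AE x in M. norm (?g x) \<le> norm (\<xi> i x)"
        using a(2) b(2) by (auto simp: abs_mult intro!: mult_le_one mult_right_le_one_le mult_left_le_one_le
            order_trans[OF mult_right_le_one_le])
    qed (rule measurable_F_M[OF g])
    moreover have "indep_var borel (\<xi> j) borel ?g"
      using ij by (intro indep g) simp
    ultimately have "expectation (\<lambda>x. \<xi> j x * ?g x) = expectation (\<xi> j) * expectation ?g"
      using ij by (intro indep_var_lebesgue_integral noise_integrable) auto
    also have "\<dots> = 0" using ij by (simp add: mean_zero)
    finally show ?thesis by (simp add: mult_ac)
  qed
  have diag: "expectation (\<lambda>x. (c j x * \<xi> j x) * (d j x * \<xi> j x)) = v * expectation (\<lambda>x. c j x * d j x)"
    if j: "1 \<le> j" for j
  proof -
    let ?g = "\<lambda>x. c j x * d j x"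
    have g: "?g \<in> borel_measurable (F (j - 1))"
      using c[OF j] d[OF j] by simp
    have "integrable M ?g"
      using measurable_F_M[OF g] c1 d1
      by (intro integrable_const_bound[where B = 1]) (auto simp: abs_mult intro!: mult_le_one)
    moreover have "indep_var borel ((\<lambda>t. t\<^sup>2) \<circ> \<xi> j) borel ((\<lambda>t. t) \<circ> ?g)"
      by (intro indep_var_compose[OF indep[OF j g]]) simp_all
    ultimately have "expectation (\<lambda>x. (\<xi> j x)\<^sup>2 * ?g x) = expectation (\<lambda>x. (\<xi> j x)\<^sup>2) * expectation ?g"
      using j by (intro indep_var_lebesgue_integral square_integrable) (auto simp: comp_def)
    then show ?thesis
      using variance[OF j] by (simp add: power2_eq_square mult_ac)
  qed
  have "expectation (\<lambda>x. (\<Sum>i=1..m. c i x * \<xi> i x) * (\<Sum>j=1..n. d j x * \<xi> j x)) =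
      (\<Sum>i=1..m. \<Sum>j=1..n. expectation (\<lambda>x. (c i x * \<xi> i x) * (d j x * \<xi> j x)))"
    unfolding prod
    by (subst Bochner_Integration.integral_sum)
      (auto intro!: Bochner_Integration.integrable_sum int sum.cong Bochner_Integration.integral_sum)
  also have "\<dots> = (\<Sum>i=1..m. \<Sum>j=1..n. if i = j then v * expectation (\<lambda>x. c j x * d j x) else 0)"
  proof (intro sum.cong refl)
    fix i j assume "i \<in> {1..m}" "j \<in> {1..n}"
    then have "1 \<le> i" "1 \<le> j" by auto
    then show "expectation (\<lambda>x. (c i x * \<xi> i x) * (d j x * \<xi> j x)) =
        (if i = j then v * expectation (\<lambda>x. c j x * d j x) else 0)"
      using diag[of i] zero[of i j "c i" "d j"] zero[of j i "d j" "c i"] c d c1 d1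
      by (cases i j rule: linorder_cases) (simp_all add: mult_ac)
  qed
  also have "\<dots> = (\<Sum>i=1..m. if i \<in> {1..n} then v * expectation (\<lambda>x. c i x * d i x) else 0)"
    by (intro sum.cong refl) (simp only: sum.delta' finite_atLeastAtMost)
  also have "\<dots> = (\<Sum>i\<in>{1..m} \<inter> {1..n}. v * expectation (\<lambda>x. c i x * d i x))"
    by (subst sum.inter_restrict) simp_all
  also have "{1..m} \<inter> {1..n} = {1..min m n}" by auto
  finally show "expectation (\<lambda>x. (\<Sum>i=1..m. c i x * \<xi> i x) * (\<Sum>j=1..n. d j x * \<xi> j x)) =
        v * (\<Sum>j=1..min m n. expectation (\<lambda>x. c j x * d j x))"
    by (simp add: sum_distrib_left)
qed

end

section \<open>Counting the pulls of an arm and ranking them\<close>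

lemma pulls_eq_sum: "pulls v a k = (\<Sum>j=1..k. if v j = a then 1 else 0)"
  unfolding pulls_def card_eq_sum by (rule sum.inter_filter) simp

lemma pulls_mono: "m \<le> n \<Longrightarrow> pulls v a m \<le> pulls v a n"
  unfolding pulls_def by (intro card_mono) auto

lemma pulls_strict_mono:
  assumes "i < j" "v j = a"
  shows "pulls v a i < pulls v a j"
  unfolding pulls_def
proof (rule psubset_card_mono)
  have "j \<in> {k \<in> {1..j}. v k = a}" "j \<notin> {k \<in> {1..i}. v k = a}"
    using assms by auto
  moreover have "{k \<in> {1..i}. v k = a} \<subseteq> {k \<in> {1..j}. v k = a}"
    using assms by auto
  ultimately show "{k \<in> {1..i}. v k = a} \<subset> {k \<in> {1..j}. v k = a}"
    by blast
qed simp

text \<open>The pulls of \<open>a\<close> are grouped by rank, the value of the counter at the pull.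
  The counter strictly increases at each pull, so rank \<open>k\<close> occurs no later than
  \<open>N k\<close>, and ranks up to \<open>pulls v a n\<close> occur no later than
  \<open>n\<close>. Hence the inner range depends on \<open>k\<close> only, not on \<open>n\<close>
  or on the path.\<close>

lemma sum_pulled_by_rank:
  fixes w :: "nat \<Rightarrow> real"
  assumes N: "\<And>k. k \<le> pulls v a (N k)"
  shows "(\<Sum>j\<in>{j\<in>{1..n}. v j = a}. w j) =
    (\<Sum>k=1..pulls v a n. \<Sum>j=1..N k. of_bool (v j = a \<and> pulls v a j = k) * w j)"
proof -
  let ?S = "{j \<in> {1..n}. v j = a}"
  have pos: "1 \<le> pulls v a j" if "v j = a" "1 \<le> j" for j
    using pulls_strict_mono[of 0 j v a] that by simp
  have "pulls v a ` ?S \<subseteq> {1..pulls v a n}"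
  proof (rule image_subsetI)
    fix j assume "j \<in> ?S"
    then show "pulls v a j \<in> {1..pulls v a n}"
      using pos[of j] pulls_mono[of j n v a] by simp
  qed
  then have "(\<Sum>j\<in>?S. w j) = (\<Sum>k=1..pulls v a n. \<Sum>j\<in>{j\<in>?S. pulls v a j = k}. w j)"
    by (intro sum.group[symmetric]) simp_all
  also have "\<dots> = (\<Sum>k=1..pulls v a n. \<Sum>j=1..N k. of_bool (v j = a \<and> pulls v a j = k) * w j)"
  proof (rule sum.cong[OF refl])
    fix k assume k: "k \<in> {1..pulls v a n}"
    have "j \<le> n \<longleftrightarrow> j \<le> N k" if j: "v j = a" "pulls v a j = k" for j
    proof
      assume "j \<le> n"
      show "j \<le> N k"
        using pulls_strict_mono[of "N k" j v a] N[of k] j by (cases "j \<le> N k") auto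
    next
      assume "j \<le> N k"
      show "j \<le> n"
        using pulls_strict_mono[of n j v a] k j by (cases "j \<le> n") auto
    qed
    then have eq: "{j\<in>?S. pulls v a j = k} = {j\<in>{1..N k}. v j = a \<and> pulls v a j = k}"
      by auto
    show "(\<Sum>j\<in>{j\<in>?S. pulls v a j = k}. w j) =
        (\<Sum>j=1..N k. of_bool (v j = a \<and> pulls v a j = k) * w j)"
      unfolding eq sum.inter_filter[OF finite_atLeastAtMost] by (intro sum.cong) auto
  qed
  finally show ?thesis .
qed

lemma rank_unique:
  assumes "v i = a" "v j = a" "pulls v a i = pulls v a j"
  shows "i = j"
  using pulls_strict_mono[of i j v a] pulls_strict_mono[of j i v a] assms
  by (cases i j rule: linorder_cases) auto

lemma measurable_pulls:
  assumes "\<And>j. j \<in> {1..n} \<Longrightarrow> \<theta> j \<in> measurable N (count_space UNIV)"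
  shows "(\<lambda>x. pulls (\<lambda>j. \<theta> j x) a n) \<in> measurable N (count_space UNIV)"
proof -
  note [measurable] = assms
  show ?thesis unfolding pulls_eq_sum by measurable
qed

context noise
begin

lemma variance_nonneg: "0 \<le> v"
  using variance[of 1] by (metis Bochner_Integration.integral_nonneg order_refl zero_le_power2)

text \<open>Passing from rounds to ranks turns a normalisation by a random count into an ordinary
  average. At most one round carries rank \<open>k\<close>, which bounds the second moments by
  \<open>v\<close>; no round carries two ranks, which gives orthogonality. The bound
  \<open>N\<close> must not depend on the path, as it is the length of a predictable sum.\<close>

lemma pulled_noise_mean_tendsto_0:
  assumes \<theta>: "\<And>j. 1 \<le> j \<Longrightarrow> \<theta> j \<in> measurable (F (j - 1)) (count_space UNIV)"
    and N: "\<And>k x. x \<in> space M \<Longrightarrow> k \<le> pulls (\<lambda>j. \<theta> j x) a (N k)"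
  shows "AE x in M. (\<lambda>n. (\<Sum>j\<in>{j\<in>{1..n}. \<theta> j x = a}. \<xi> j x) / real (pulls (\<lambda>j. \<theta> j x) a n)) \<longlonglongrightarrow> 0"
proof -
  define c :: "nat \<Rightarrow> nat \<Rightarrow> 'a \<Rightarrow> real"
    where "c k j x = of_bool (\<theta> j x = a \<and> pulls (\<lambda>j. \<theta> j x) a j = k)" for k j x
  \<comment> \<open>The noise met at the \<open>k\<close>-th pull of \<open>a\<close>, a finite sum because this pull happens by time \<open>N k\<close>.\<close>
  define Y where "Y k x = (\<Sum>j=1..N k. c k j x * \<xi> j x)" for k x
  have c_meas: "c k j \<in> borel_measurable (F (j - 1))" if "1 \<le> j" for k j
  proof -
    \<comment> \<open>The count including round \<open>j\<close> is already known at time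
      \<open>j - 1\<close>, since the choice \<open>\<theta> j\<close> precedes the reward of that
      round.\<close>
    have "(\<lambda>x. pulls (\<lambda>j. \<theta> j x) a j) \<in> measurable (F (j - 1)) (count_space UNIV)"
      by (intro measurable_pulls measurable_F_mono[OF \<theta>]) auto
    note [measurable] = \<theta>[OF that] this
    show ?thesis unfolding c_def by measurable
  qed
  have c_le: "\<bar>c k j x\<bar> \<le> 1" for k j x
    by (simp add: c_def)
  have c_M [measurable]: "c k j \<in> borel_measurable M" if "1 \<le> j" for k j
    using measurable_F_M[OF c_meas[OF that]] .
  have int_cc: "integrable M (\<lambda>x. c k j x * c k j x)" if "1 \<le> j" for k j
  proof (rule integrable_const_bound[where B = 1])
    show "AE x in M. norm (c k j x * c k j x) \<le> 1"
      by (simp add: c_def)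
  qed (use c_M[OF that] in measurable)
  have Y_meas [measurable]: "Y k \<in> borel_measurable M" for k
    unfolding Y_def using noise_measurable by (intro borel_measurable_sum borel_measurable_times c_M) auto
  have "AE x in M. (\<lambda>n. (\<Sum>k=1..n. Y k x) / real n) \<longlonglongrightarrow> 0"
  proof (rule strong_law_orthogonal[where C = v])
    fix k
    show "integrable M (\<lambda>x. (Y k x)\<^sup>2)"
      unfolding Y_def power2_eq_square
      by (intro predictable_sums_integrable c_meas c_le)
    have "expectation (\<lambda>x. (Y k x)\<^sup>2) = v * (\<Sum>j=1..N k. expectation (\<lambda>x. c k j x * c k j x))"
      unfolding Y_def power2_eq_square
      by (subst predictable_sums_isometry) (use c_meas c_le in simp_all)
    also have "\<dots> = v * expectation (\<lambda>x. \<Sum>j=1..N k. c k j x * c k j x)"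
      by (intro arg_cong[where f = "\<lambda>t. v * t"] Bochner_Integration.integral_sum[symmetric] int_cc) auto
    also have "\<dots> \<le> v * 1"
    proof (rule mult_left_mono[OF _ variance_nonneg])
      have "(\<Sum>j=1..N k. c k j x * c k j x) \<le> 1" for x
      proof -
        let ?J = "{j\<in>{1..N k}. \<theta> j x = a \<and> pulls (\<lambda>j. \<theta> j x) a j = k}"
        have "(\<Sum>j=1..N k. c k j x * c k j x) = real (card ?J)"
          by (simp add: c_def Int_def)
        moreover have "card ?J \<le> 1"
          by (intro card_le_Suc0_iff_eq[THEN iffD2, unfolded One_nat_def[symmetric]])
            (auto dest: rank_unique[of "\<lambda>j. \<theta> j x"])
        ultimately show ?thesis by simp
      qed
      then have "expectation (\<lambda>x. \<Sum>j=1..N k. c k j x * c k j x) \<le> expectation (\<lambda>x. 1)"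
        by (intro integral_mono Bochner_Integration.integrable_sum int_cc) auto
      then show "expectation (\<lambda>x. \<Sum>j=1..N k. c k j x * c k j x) \<le> 1"
        by (simp add: prob_space)
    qed
    finally show "expectation (\<lambda>x. (Y k x)\<^sup>2) \<le> v" by simp
  next
    fix k l :: nat assume "k \<noteq> l"
    then have zero: "c k j x * c l j x = 0" for j x
      by (simp add: c_def)
    have "expectation (\<lambda>x. Y k x * Y l x) =
        v * (\<Sum>j=1..min (N k) (N l). expectation (\<lambda>x. c k j x * c l j x))"
      unfolding Y_def by (subst predictable_sums_isometry) (use c_meas c_le in simp_all)
    also have "\<dots> = 0"
      unfolding zero by simp
    finally show "expectation (\<lambda>x. Y k x * Y l x) = 0" .
  qed simp
  then have "AE x in M. x \<in> space M \<and> (\<lambda>n. (\<Sum>k=1..n. Y k x) / real n) \<longlonglongrightarrow> 0"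
    by simp
  then show ?thesis
  proof eventually_elim
    case (elim x)
    then have x: "x \<in> space M" and Y_lim: "(\<lambda>n. (\<Sum>k=1..n. Y k x) / real n) \<longlonglongrightarrow> 0"
      by blast+
    define m where "m = pulls (\<lambda>j. \<theta> j x) a"
    have m_lim: "filterlim m at_top sequentially"
      unfolding filterlim_at_top
    proof
      fix k
      show "\<forall>\<^sub>F n in sequentially. k \<le> m n"
        using eventually_ge_at_top[of "N k"]
      proof eventually_elim
        case (elim n)
        then show ?case
          using N[OF x, of k] pulls_mono[OF elim, of "\<lambda>j. \<theta> j x" a]
          by (simp add: m_def)
      qed
    qed
    \<comment> \<open>The path is fixed here, so the limit over ranks can be evaluated along the
      path-dependent counter \<open>m\<close>.\<close>
    have "(\<lambda>n. (\<Sum>k=1..m n. Y k x) / real (m n)) \<longlonglongrightarrow> 0"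
      by (rule filterlim_compose[OF Y_lim m_lim])
    moreover have "(\<Sum>k=1..m n. Y k x) = (\<Sum>j\<in>{j\<in>{1..n}. \<theta> j x = a}. \<xi> j x)" for n
      unfolding sum_pulled_by_rank[of "\<lambda>j. \<theta> j x" a N, OF N[OF x]] Y_def c_def m_def ..
    ultimately show ?case by (simp add: m_def)
  qed
qed

text \<open>Chebyshev's inequality. Normalising by \<open>n\<close> instead of by the number of
  pulls makes the bound the same for every strategy, even one that hardly ever pulls
  \<open>a\<close>: the second moment is \<open>v\<close> times the expected number of pulls, hence
  at most \<open>v * n\<close>.\<close>

lemma pulled_noise_weak_law:
  assumes \<theta>: "\<And>j. 1 \<le> j \<Longrightarrow> \<theta> j \<in> measurable (F (j - 1)) (count_space UNIV)"
    and "0 < \<delta>" and "0 < n"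
  shows "prob {x \<in> space M. \<delta> \<le> \<bar>(\<Sum>j=1..n. of_bool (\<theta> j x = a) * \<xi> j x) / real n\<bar>} \<le> v / (\<delta>\<^sup>2 * real n)"
proof -
  define c :: "nat \<Rightarrow> 'a \<Rightarrow> real" where "c j x = of_bool (\<theta> j x = a)" for j x
  define D where "D x = (\<Sum>j=1..n. c j x * \<xi> j x)" for x
  have c: "c j \<in> borel_measurable (F (j - 1))" if "1 \<le> j" for j
  proof -
    note [measurable] = \<theta>[OF that]
    show ?thesis unfolding c_def by measurable
  qed
  have c_le: "\<bar>c j x\<bar> \<le> 1" for j x
    by (simp add: c_def)
  have int: "integrable M (\<lambda>x. (D x)\<^sup>2)"
    unfolding D_def power2_eq_square by (intro predictable_sums_integrable c c_le)
  have "expectation (\<lambda>x. (D x)\<^sup>2) = v * (\<Sum>j=1..n. expectation (\<lambda>x. c j x * c j x))"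
    unfolding D_def power2_eq_square by (subst predictable_sums_isometry) (use c c_le in simp_all)
  also have "\<dots> \<le> v * (\<Sum>j=1..n. 1)"
  proof (intro mult_left_mono sum_mono variance_nonneg)
    fix j assume "j \<in> {1..n}"
    then have [measurable]: "c j \<in> borel_measurable M"
      using measurable_F_M[OF c] by simp
    have "integrable M (\<lambda>x. c j x * c j x)"
    proof (rule integrable_const_bound[where B = 1])
      show "AE x in M. norm (c j x * c j x) \<le> 1"
        by (simp add: c_def)
    qed measurable
    then have "expectation (\<lambda>x. c j x * c j x) \<le> expectation (\<lambda>x. 1)"
      by (intro integral_mono) (auto simp: c_def)
    then show "expectation (\<lambda>x. c j x * c j x) \<le> 1" by (simp add: prob_space)
  qed
  finally have ED: "expectation (\<lambda>x. (D x)\<^sup>2) \<le> v * real n" by simp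
  have "\<delta> \<le> \<bar>D x / real n\<bar> \<longleftrightarrow> (\<delta> * real n)\<^sup>2 \<le> (D x)\<^sup>2" for x
  proof -
    have "\<delta> \<le> \<bar>D x / real n\<bar> \<longleftrightarrow> \<delta> * real n \<le> \<bar>D x\<bar>"
      using \<open>0 < n\<close> by (simp add: pos_le_divide_eq)
    also have "\<dots> \<longleftrightarrow> (\<delta> * real n)\<^sup>2 \<le> (D x)\<^sup>2"
      using \<open>0 < \<delta>\<close> by (simp add: abs_le_square_iff[symmetric])
    finally show ?thesis .
  qed
  then have "prob {x \<in> space M. \<delta> \<le> \<bar>D x / real n\<bar>} = prob {x \<in> space M. (\<delta> * real n)\<^sup>2 \<le> (D x)\<^sup>2}"
    by simp
  also have "\<dots> \<le> expectation (\<lambda>x. (D x)\<^sup>2) / (\<delta> * real n)\<^sup>2"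
    using assms by (intro integral_Markov_inequality_measure[OF int]) auto
  also have "\<dots> \<le> v * real n / (\<delta> * real n)\<^sup>2"
    by (intro divide_right_mono ED) simp
  also have "\<dots> = v / (\<delta>\<^sup>2 * real n)"
    using \<open>0 < n\<close> by (simp add: power2_eq_square field_simps)
  finally show ?thesis by (simp add: D_def c_def)
qed

end

section \<open>Independence of the joint family of rewards\<close>

text \<open>A finite set of indices splits into a slice per family. The two slices give cylinder
  events, which are independent of each other by \<open>XY\<close>; within each slice the
  probability factors by independence of that family.\<close>

lemma (in prob_space) indep_vars_pair_of_families:
  assumes X: "indep_vars (\<lambda>_. N) X I" and Y: "indep_vars (\<lambda>_. N) Y I"
    and XY: "indep_var (PiM I (\<lambda>_. N)) (\<lambda>\<omega>. \<lambda>i\<in>I. X i \<omega>) (PiM I (\<lambda>_. N)) (\<lambda>\<omega>. \<lambda>i\<in>I. Y i \<omega>)"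
  shows "indep_vars (\<lambda>_. N) (\<lambda>(b, i). if b then X i else Y i) (UNIV \<times> I)"
proof -
  define Z where "Z = (\<lambda>(b, i). if b then X i else Y i)"
  have Z [simp]: "Z (True, i) = X i" "Z (False, i) = Y i" for i
    by (auto simp: Z_def)
  have fam: "indep_vars (\<lambda>_. N) (\<lambda>i. Z (b, i)) I" for b
    using X Y by (cases b) simp_all
  have rv: "random_variable N (Z (b, i))" if "i \<in> I" for b i
    using fam[of b] that by (auto simp: indep_vars_def2)
  have "indep_sets (\<lambda>p. {Z p -` A \<inter> space M | A. A \<in> sets N}) (UNIV \<times> I)"
  proof (rule indep_setsI)
    fix p assume "p \<in> (UNIV :: bool set) \<times> I"
    then show "{Z p -` A \<inter> space M | A. A \<in> sets N} \<subseteq> events"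
      using rv by (cases p) (auto intro: measurable_sets)
  next
    fix A and J :: "(bool \<times> 'b) set"
    assume J: "J \<noteq> {}" "J \<subseteq> UNIV \<times> I" "finite J"
      and "\<forall>p\<in>J. A p \<in> {Z p -` A \<inter> space M | A. A \<in> sets N}"
    then have "\<forall>p\<in>J. \<exists>B. A p = Z p -` B \<inter> space M \<and> B \<in> sets N" by auto
    then obtain B where B: "\<And>p. p \<in> J \<Longrightarrow> A p = Z p -` B p \<inter> space M" "\<And>p. p \<in> J \<Longrightarrow> B p \<in> sets N"
      by metis
    define K where "K b = {i. (b, i) \<in> J}" for b
    have K: "finite (K b)" "K b \<subseteq> I" for b
    proof -
      have "K b = snd ` (J \<inter> {b} \<times> UNIV)" by (force simp: K_def)
      then show "finite (K b)" using J by simp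
      show "K b \<subseteq> I" using J by (auto simp: K_def)
    qed
    \<comment> \<open>Written with a bounded quantifier rather than an intersection, so that an
      empty slice yields the whole space, matching the empty product 1.\<close>
    define E where "E b = {\<omega> \<in> space M. \<forall>i\<in>K b. Z (b, i) \<omega> \<in> B (b, i)}" for b
    have E: "prob (E b) = (\<Prod>i\<in>K b. prob (A (b, i)))" for b
    proof (cases "K b = {}")
      case True
      then show ?thesis by (simp add: E_def prob_space)
    next
      case False
      have "E b = (\<Inter>i\<in>K b. A (b, i))"
        using False B(1) by (auto simp: E_def K_def)
      moreover have "indep_sets (\<lambda>i. {Z (b, i) -` A \<inter> space M | A. A \<in> sets N}) I"
        using fam[of b] by (simp add: indep_vars_def2)
      ultimately show ?thesis
        using K False B by (simp only:) (rule indep_setsD, auto simp: K_def)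
    qed
    have set: "{x \<in> space (PiM I (\<lambda>_. N)). \<forall>i\<in>K b. x i \<in> B (b, i)} \<in> sets (PiM I (\<lambda>_. N))" for b
    proof -
      have [measurable]: "B (b, i) \<in> sets N" if "i \<in> K b" for i
        using that B by (auto simp: K_def)
      have [measurable]: "(\<lambda>x. x i) \<in> measurable (PiM I (\<lambda>_. N)) N" if "i \<in> K b" for i
        using that K[of b] by (intro measurable_component_singleton) auto
      show ?thesis using K(1)[of b] by measurable
    qed
    have pre: "(\<lambda>\<omega>. \<lambda>i\<in>I. Z (b, i) \<omega>) -` {x \<in> space (PiM I (\<lambda>_. N)). \<forall>i\<in>K b. x i \<in> B (b, i)} \<inter> space M = E b" for b
      using K(2)[of b] rv[THEN measurable_space] by (auto simp: E_def space_PiM)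
    have Ab: "(\<Inter>p\<in>J. A p) = E True \<inter> E False"
    proof -
      have "(\<Inter>p\<in>J. A p) = {\<omega> \<in> space M. \<forall>p\<in>J. Z p \<omega> \<in> B p}"
        using J(1) B(1) by auto
      also have "\<dots> = E True \<inter> E False"
      proof -
        have "(\<forall>p\<in>J. Q p) \<longleftrightarrow> (\<forall>i\<in>K True. Q (True, i)) \<and> (\<forall>i\<in>K False. Q (False, i))" for Q
          unfolding K_def by (simp add: Ball_def all_bool_eq)
        then show ?thesis by (auto simp: E_def)
      qed
      finally show ?thesis .
    qed
    have "prob (E True \<inter> E False) = prob (E True) * prob (E False)"
    proof -
      let ?G = "\<lambda>b. {x \<in> space (PiM I (\<lambda>_. N)). \<forall>i\<in>K b. x i \<in> B (b, i)}"
      have "(\<lambda>\<omega>. (\<lambda>i\<in>I. X i \<omega>, \<lambda>i\<in>I. Y i \<omega>)) -` (?G True \<times> ?G False) \<inter> space M =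
          ((\<lambda>\<omega>. \<lambda>i\<in>I. X i \<omega>) -` ?G True \<inter> space M) \<inter> ((\<lambda>\<omega>. \<lambda>i\<in>I. Y i \<omega>) -` ?G False \<inter> space M)"
        by auto
      then show ?thesis
        using indep_varD[OF XY set[of True] set[of False]] pre[of True] pre[of False] by simp
    qed
    also have "\<dots> = (\<Prod>i\<in>K True. prob (A (True, i))) * (\<Prod>i\<in>K False. prob (A (False, i)))"
      by (simp add: E)
    also have "\<dots> = (\<Prod>p\<in>Pair True ` K True \<union> Pair False ` K False. prob (A p))"
      using K by (subst prod.union_disjoint) (auto simp: prod.reindex inj_on_def)
    also have "Pair True ` K True \<union> Pair False ` K False = J"
      by (simp add: set_eq_iff K_def image_iff all_bool_eq)
    finally show "prob (\<Inter>p\<in>J. A p) = (\<Prod>p\<in>J. prob (A p))"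
      by (simp add: Ab)
  qed
  then show ?thesis
    using rv by (auto simp: indep_vars_def2 Z_def)
qed

text \<open>The generator is the union of the preimage systems of the single variables, the shape in
  which independent systems are collected into blocks.\<close>

definition sigma_gen :: "'a measure \<Rightarrow> ('i \<Rightarrow> 'a \<Rightarrow> real) \<Rightarrow> 'i set \<Rightarrow> 'a measure"
  where "sigma_gen M Z K = sigma (space M) (\<Union>k\<in>K. {Z k -` A \<inter> space M | A. A \<in> sets borel})"

lemma sets_sigma_gen:
  "sets (sigma_gen M Z K) = sigma_sets (space M) (\<Union>k\<in>K. {Z k -` A \<inter> space M | A. A \<in> sets borel})"
  unfolding sigma_gen_def by (rule sets_measure_of) auto

lemma space_sigma_gen [simp]: "space (sigma_gen M Z K) = space M"
  unfolding sigma_gen_def by (rule space_measure_of) auto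

lemma measurable_sigma_gen: "k \<in> K \<Longrightarrow> Z k \<in> borel_measurable (sigma_gen M Z K)"
  by (rule measurableI) (auto simp: sets_sigma_gen intro!: sigma_sets.Basic)

lemma sigma_gen_mono: "K \<subseteq> K' \<Longrightarrow> sets (sigma_gen M Z K) \<subseteq> sets (sigma_gen M Z K')"
  unfolding sets_sigma_gen by (intro sigma_sets_mono') blast

lemma subalgebra_sigma_gen:
  assumes "space N = space M" and "\<And>k. k \<in> K \<Longrightarrow> Z k \<in> borel_measurable N"
  shows "subalgebra N (sigma_gen M Z K)"
proof -
  have "(\<Union>k\<in>K. {Z k -` A \<inter> space M | A. A \<in> sets borel}) \<subseteq> sets N"
    using assms(2) by (auto simp: assms(1)[symmetric] intro: measurable_sets)
  then show ?thesis
    using sets.sigma_sets_subset[of _ N] by (simp add: subalgebra_def sets_sigma_gen assms(1))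
qed

text \<open>The blocks \<open>{i}\<close> and \<open>K\<close> are disjoint and all generating
  systems are closed under intersection, so the sigma-algebras of the blocks are independent. The
  one generated by \<open>g\<close> is contained in that of \<open>K\<close>.\<close>

lemma (in prob_space) indep_var_sigma_gen:
  assumes Z: "indep_vars (\<lambda>_. borel) Z I" and "i \<in> I" "K \<subseteq> I" "i \<notin> K"
    and g: "g \<in> borel_measurable (sigma_gen M Z K)"
  shows "indep_var borel (Z i) borel g"
proof -
  let ?E = "\<lambda>k. {Z k -` A \<inter> space M | A. A \<in> sets borel}"
  have rv: "random_variable borel (Z k)" if "k \<in> I" for k
    using Z that by (auto simp: indep_vars_def2)
  have "subalgebra M (sigma_gen M Z K)"
    using \<open>K \<subseteq> I\<close> rv by (intro subalgebra_sigma_gen) auto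
  then have gM: "random_variable borel g"
    using g by (rule measurable_from_subalg)
  have *: "indep_sets (\<lambda>b. sigma_sets (space M) (\<Union>k\<in>case_bool {i} K b. ?E k)) UNIV"
  proof (rule indep_sets_collect_sigma)
    have "indep_sets ?E I"
      using Z by (simp add: indep_vars_def2)
    then show "indep_sets ?E (\<Union>b\<in>UNIV. case_bool {i} K b)"
      by (rule indep_sets_mono_index[rotated]) (use assms in \<open>auto simp: UNIV_bool\<close>)
    show "Int_stable (?E k)" for k
    proof (rule Int_stableI)
      fix a b assume "a \<in> ?E k" "b \<in> ?E k"
      then obtain A B where "a = Z k -` A \<inter> space M" "b = Z k -` B \<inter> space M"
        "A \<in> sets borel" "B \<in> sets borel" by auto
      then have "a \<inter> b = Z k -` (A \<inter> B) \<inter> space M" "A \<inter> B \<in> sets borel" by auto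
      then show "a \<inter> b \<in> ?E k" by blast
    qed
    show "disjoint_family_on (case_bool {i} K) UNIV"
      using \<open>i \<notin> K\<close> by (auto simp: disjoint_family_on_def UNIV_bool)
  qed
  have "indep_set (sigma_sets (space M) (?E i)) (sets (sigma_gen M Z K))"
    unfolding indep_set_def
    by (rule indep_sets_mono_sets[OF *]) (auto split: bool.splits simp: sets_sigma_gen)
  moreover have "sigma_sets (space M) {g -` A \<inter> space M | A. A \<in> sets borel} \<subseteq> sets (sigma_gen M Z K)"
  proof -
    have "{g -` A \<inter> space M | A. A \<in> sets borel} \<subseteq> sets (sigma_gen M Z K)"
      using measurable_sets[OF g] by auto
    from sets.sigma_sets_subset[OF this] show ?thesis by simp
  qed
  ultimately have "indep_set (sigma_sets (space M) (?E i))
      (sigma_sets (space M) {g -` A \<inter> space M | A. A \<in> sets borel})"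
    unfolding indep_set_def by (elim indep_sets_mono_sets) (auto split: bool.splits)
  then show ?thesis
    using rv[OF \<open>i \<in> I\<close>] gM by (simp add: indep_var_eq)
qed

section \<open>Paths of the strategy\<close>

text \<open>Besides the forced rounds this contains the initial rounds 1 and 2 (as \<open>i = 1\<close>) and the dummy 0.\<close>

definition scheduled :: "nat set"
  where "scheduled = range (\<lambda>i. 2 ^ i - 1) \<union> range (\<lambda>i. 2 ^ i)"

lemma gamma_rule_unscheduled:
  assumes "k \<notin> scheduled"
  shows "gamma_rule \<gamma> wL wR v k =
    (if arm_mean wL v 1 (k - 1) \<ge> arm_mean wR v 2 (k - 1)
     then (if real (pulls v 1 (k - 1)) / real (k - 1) < \<gamma> then 1 else 2)
     else (if real (pulls v 2 (k - 1)) / real (k - 1) < \<gamma> then 2 else 1))"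
proof -
  have *: "k \<noteq> 2 ^ i - 1" "k \<noteq> 2 ^ i" for i
    using assms unfolding scheduled_def by blast+
  have "\<not> k \<le> 1" "k \<noteq> 2"
    using *(1)[of 0] *(2)[of 0] *(2)[of 1] by auto
  moreover have "(\<exists>i>1. k = 2 ^ i - 1) = False" "(\<exists>i>1. k = 2 ^ i) = False"
    using * by blast+
  ultimately show ?thesis
    unfolding gamma_rule_def by (simp only: if_False)
qed

lemma gamma_rule_cases: "gamma_rule \<gamma> wL wR v k = 1 \<or> gamma_rule \<gamma> wL wR v k = 2"
  by (simp add: gamma_rule_def)

lemma gamma_rule_left: "gamma_rule \<gamma> wL wR v (2 ^ Suc i - 1) = 1"
proof (cases i)
  case (Suc j)
  define t where "t = (2::nat) ^ Suc i - 1"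
  have "2 ^ 2 \<le> (2::nat) ^ Suc i" using Suc by (intro power_increasing) auto
  then have "t \<ge> 3" by (simp add: t_def)
  moreover have "\<exists>l>1. t = 2 ^ l - 1"
    using Suc by (intro exI[of _ "Suc i"]) (simp add: t_def)
  ultimately show ?thesis unfolding gamma_rule_def t_def[symmetric] by simp
qed (simp add: gamma_rule_def)

lemma pow2_ne_pow2_minus_1: "(2::nat) ^ Suc i \<noteq> 2 ^ Suc j - 1"
proof -
  \<comment> \<open>An even number against an odd one. Positivity matters because subtraction
    truncates: \<open>2 * 0 - 1\<close> would be even.\<close>
  have "1 \<le> (2::nat) ^ j" by simp
  moreover have "2 * x \<noteq> 2 * y - 1" if "1 \<le> y" for x y :: nat
    using that by presburger
  ultimately show ?thesis by (simp only: power_Suc not_False_eq_True)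
qed

lemma gamma_rule_right: "gamma_rule \<gamma> wL wR v (2 ^ Suc i) = 2"
proof (cases i)
  case (Suc j)
  define t where "t = (2::nat) ^ Suc i"
  have "2 ^ 2 \<le> t" unfolding t_def using Suc by (intro power_increasing) auto
  then have "\<not> t \<le> 1" "t \<noteq> 2" by simp_all
  \<comment> \<open>The branch for \<open>2 ^ l - 1\<close> is tested first and has to be
    excluded.\<close>
  moreover have "\<nexists>l. 1 < l \<and> t = 2 ^ l - 1"
  proof
    assume "\<exists>l. 1 < l \<and> t = 2 ^ l - 1"
    then obtain l where "1 < l" "t = 2 ^ l - 1" by blast
    then show False
      using pow2_ne_pow2_minus_1[of i "l - 1"] by (simp add: t_def del: power_Suc)
  qed
  moreover have "\<exists>l>1. t = 2 ^ l"
    using Suc by (intro exI[of _ "Suc i"]) (simp add: t_def)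
  ultimately show ?thesis
    unfolding gamma_rule_def t_def[symmetric] by (simp only: if_False if_True)
qed (simp add: gamma_rule_def)

section \<open>Forced pulls keep both counters growing\<close>

lemma le_pulls_if_hit:
  assumes "strict_mono_on {1..} t" and "\<And>i. 1 \<le> i \<Longrightarrow> 1 \<le> t i" and "\<And>i. 1 \<le> i \<Longrightarrow> t i \<le> N i"
    and "\<And>i. 1 \<le> i \<Longrightarrow> v (t i) = a"
  shows "k \<le> pulls v a (N k)"
proof -
  have "card (t ` {1..k}) = k"
    using inj_on_subset[OF strict_mono_on_imp_inj_on[OF assms(1)], of "{1..k}"]
    by (simp add: card_image subset_eq)
  moreover have "t ` {1..k} \<subseteq> {j \<in> {1..N k}. v j = a}"
  proof safe
    fix i assume i: "i \<in> {1..k}"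
    then have "t i \<le> t k"
      using strict_mono_on_leD[OF assms(1), of i k] by auto
    also have "\<dots> \<le> N k" using i by (intro assms) auto
    finally show "t i \<in> {1..N k}" using assms(2)[of i] i by auto
    show "v (t i) = a" using assms(4) i by auto
  qed
  then have "card (t ` {1..k}) \<le> pulls v a (N k)"
    unfolding pulls_def by (intro card_mono) auto
  ultimately show ?thesis by simp
qed

text \<open>The left arm is hit at the rounds \<open>2 ^ i - 1\<close>, the right arm at
  \<open>2 ^ i\<close>; \<open>i = 1\<close> gives the initial rounds 1 and 2. Both times are at
  most \<open>2 ^ i\<close>, so one deterministic bound serves both arms.\<close>

lemma le_pulls_gamma_rule:
  assumes "\<And>k. v k = gamma_rule \<gamma> wL wR v k" and "a \<in> {1, 2}"
  shows "k \<le> pulls v a (2 ^ k)"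
proof (rule le_pulls_if_hit[where t = "\<lambda>i. if a = 1 then 2 ^ i - 1 else 2 ^ i"])
  show "strict_mono_on {1..} (\<lambda>i. if a = 1 then 2 ^ i - 1 else 2 ^ i :: nat)"
  proof (rule strict_mono_onI)
    fix i j :: nat assume "i < j"
    then have "(2::nat) ^ i < 2 ^ j" by simp
    moreover have "(1::nat) \<le> 2 ^ i" by simp
    ultimately show "(if a = 1 then 2 ^ i - 1 else 2 ^ i :: nat) < (if a = 1 then 2 ^ j - 1 else 2 ^ j)"
      by (simp add: diff_less_mono)
  qed
  show "v (if a = 1 then 2 ^ i - 1 else 2 ^ i) = a" if "1 \<le> i" for i
  proof -
    obtain j where j: "i = Suc j" using \<open>1 \<le> i\<close> by (cases i) auto
    have "v (2 ^ Suc j - 1) = 1" "v (2 ^ Suc j) = 2"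
      unfolding assms(1)[of "2 ^ Suc j - 1"] assms(1)[of "2 ^ Suc j"]
      by (rule gamma_rule_left gamma_rule_right)+
    then show ?thesis using \<open>a \<in> {1, 2}\<close> by (auto simp: j simp del: power_Suc)
  qed
  show "1 \<le> (if a = 1 then 2 ^ i - 1 else 2 ^ i :: nat)" if "1 \<le> i" for i
  proof -
    have "(2::nat) ^ 1 \<le> 2 ^ i" using that by (intro power_increasing) auto
    then obtain l where "(2::nat) ^ i = 2 + l"
      by (auto simp: le_iff_add)
    then show ?thesis by simp
  qed
  show "(if a = 1 then 2 ^ i - 1 else 2 ^ i :: nat) \<le> 2 ^ i" for i
    by simp
qed

section \<open>Error of a steered frequency\<close>

lemma card_scheduled_le:
  "real (card (scheduled \<inter> {1..n})) \<le> 2 * (log 2 (real n + 1) + 1)"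
proof -
  \<comment> \<open>The largest exponent that matters: \<open>2 ^ i - 1 \<le> n\<close> means
    \<open>2 ^ i \<le> n + 1\<close>, whence the shift by 1 inside the logarithm.\<close>
  define L where "L = nat \<lfloor>log 2 (real n + 1)\<rfloor>"
  have L: "i \<le> L" if "2 ^ i \<le> n + 1" for i
  proof -
    have "real (2 ^ i) \<le> real (n + 1)"
      using that by (simp only: of_nat_le_iff)
    then have "(2::real) ^ i \<le> real n + 1" by simp
    then have "real i \<le> log 2 (real n + 1)"
      by (simp add: le_log_iff powr_realpow)
    then show ?thesis by (simp add: L_def le_nat_floor)
  qed
  have "scheduled \<inter> {1..n} \<subseteq> (\<lambda>i. 2 ^ i - 1) ` {..L} \<union> (\<lambda>i. 2 ^ i) ` {..L}"
    using L by (force simp: scheduled_def)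
  then have "card (scheduled \<inter> {1..n}) \<le> card ((\<lambda>i. 2 ^ i - 1 :: nat) ` {..L} \<union> (\<lambda>i. 2 ^ i) ` {..L})"
    by (intro card_mono) auto
  also have "\<dots> \<le> card ((\<lambda>i. 2 ^ i - 1 :: nat) ` {..L}) + card ((\<lambda>i. 2 ^ i :: nat) ` {..L})"
    by (rule card_Un_le)
  also have "\<dots> \<le> (L + 1) + (L + 1)"
    by (intro add_mono order.trans[OF card_image_le]) auto
  finally have "real (card (scheduled \<inter> {1..n})) \<le> real ((L + 1) + (L + 1))"
    by (simp only: of_nat_le_iff)
  moreover have "real L \<le> log 2 (real n + 1)"
    by (simp add: L_def)
  ultimately show ?thesis by simp
qed

lemma pulls_Suc: "pulls v a (Suc k) = pulls v a k + of_bool (v (Suc k) = a)"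
  by (simp add: pulls_eq_sum)

text \<open>Outside \<open>S\<close> each step moves the error towards 0 or across it, so only rounds in \<open>S\<close> enlarge it.\<close>

lemma pulls_fraction_error:
  assumes \<gamma>: "0 \<le> \<gamma>" "\<gamma> \<le> 1" and "1 \<le> K" "K \<le> n"
    and steer: "\<And>k. k > K \<Longrightarrow> k \<notin> S \<Longrightarrow> v k = a \<longleftrightarrow> real (pulls v a (k - 1)) / real (k - 1) < \<gamma>"
  shows "\<bar>real (pulls v a n) - \<gamma> * real n\<bar> \<le>
    max 1 \<bar>real (pulls v a K) - \<gamma> * real K\<bar> + real (card (S \<inter> {1..n}))"
  using \<open>K \<le> n\<close>
proof (induction n rule: dec_induct)
  case base
  then show ?case by simp
next
  case (step n)
  \<comment> \<open>The maximum with 1 absorbs overshooting: a steering step that crosses 0 ends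
    within distance 1 of it.\<close>
  define B where "B = max 1 \<bar>real (pulls v a K) - \<gamma> * real K\<bar>"
  have B: "1 \<le> B" by (simp add: B_def)
  note IH = step.IH[folded B_def]
  show ?case
  proof (cases "Suc n \<in> S")
    \<comment> \<open>A round in \<open>S\<close> may go the wrong way, but it changes the error by
      at most 1, paid for by the growth of the cardinality.\<close>
    case True
    then have "S \<inter> {1..Suc n} = insert (Suc n) (S \<inter> {1..n})" by auto
    then have "card (S \<inter> {1..Suc n}) = Suc (card (S \<inter> {1..n}))" by simp
    then show ?thesis
      using IH \<gamma> unfolding B_def[symmetric] pulls_Suc by (auto simp: algebra_simps abs_le_iff)
  next
    case False
    then have S: "S \<inter> {1..Suc n} = S \<inter> {1..n}" by (auto simp: le_Suc_eq)
    \<comment> \<open>Round \<open>Suc n\<close> consults the fraction over the first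
      \<open>n\<close> rounds, and \<open>1 \<le> K\<close> makes its denominator positive.\<close>
    have "v (Suc n) = a \<longleftrightarrow> real (pulls v a n) < \<gamma> * real n"
      using steer[of "Suc n"] False step.hyps \<open>1 \<le> K\<close> by (simp add: pos_divide_less_eq)
    then show ?thesis
      using IH \<gamma> B unfolding B_def[symmetric] S pulls_Suc
      by (cases "v (Suc n) = a") (auto simp: algebra_simps abs_le_iff)
  qed
qed

text \<open>The counts deviate from \<open>\<gamma> * n\<close> by a constant plus a logarithm,
  which vanishes after division by \<open>n\<close>. The constant depends on when the steering sets
  in, hence on the path.\<close>

lemma pulls_fraction_tendsto:
  assumes \<gamma>: "0 \<le> \<gamma>" "\<gamma> \<le> 1"
    and steer: "\<forall>\<^sub>F k in sequentially. k \<notin> scheduled \<longrightarrow>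
      (v k = a \<longleftrightarrow> real (pulls v a (k - 1)) / real (k - 1) < \<gamma>)"
  shows "(\<lambda>n. real (pulls v a n) / real n) \<longlonglongrightarrow> \<gamma>"
proof -
  from steer obtain K0 where K0: "\<And>k. k \<ge> K0 \<Longrightarrow> k \<notin> scheduled \<Longrightarrow>
      v k = a \<longleftrightarrow> real (pulls v a (k - 1)) / real (k - 1) < \<gamma>"
    unfolding eventually_sequentially by blast
  define K where "K = max 1 K0"
  define B where "B = max 1 \<bar>real (pulls v a K) - \<gamma> * real K\<bar>"
  have "\<forall>\<^sub>F n in sequentially. norm (real (pulls v a n) / real n - \<gamma>) \<le>
      (B + 2 * (log 2 (real n + 1) + 1)) / real n"
    using eventually_ge_at_top[of K]
  proof eventually_elim
    case (elim n)
    then have "0 < n" by (simp add: K_def)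
    have "\<bar>real (pulls v a n) - \<gamma> * real n\<bar> \<le> B + real (card (scheduled \<inter> {1..n}))"
      unfolding B_def by (rule pulls_fraction_error[OF \<gamma> _ elim]) (auto simp: K_def K0)
    also have "\<dots> \<le> B + 2 * (log 2 (real n + 1) + 1)"
      using card_scheduled_le by simp
    finally have *: "\<bar>real (pulls v a n) - \<gamma> * real n\<bar> / real n \<le>
        (B + 2 * (log 2 (real n + 1) + 1)) / real n"
      by (rule divide_right_mono) simp
    have "real (pulls v a n) / real n - \<gamma> = (real (pulls v a n) - \<gamma> * real n) / real n"
      using \<open>0 < n\<close> by (simp add: field_simps)
    with * show ?case by simp
  qed
  moreover have "(\<lambda>n. (B + 2 * (log 2 (real n + 1) + 1)) / real n) \<longlonglongrightarrow> 0"
    by real_asymp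
  ultimately have "(\<lambda>n. real (pulls v a n) / real n - \<gamma>) \<longlonglongrightarrow> 0"
    by (rule Lim_null_comparison)
  then show ?thesis by (simp add: LIM_zero_iff)
qed

text \<open>Valid even before the first pull, where the sum is empty and the factor
  \<open>pulls v a n\<close> is 0.\<close>

lemma arm_mean_times_pulls: "real (pulls v a n) * arm_mean w v a n = (\<Sum>j\<in>{j\<in>{1..n}. v j = a}. w j)"
proof (cases "pulls v a n = 0")
  case True
  then have "{j\<in>{1..n}. v j = a} = {}" by (simp add: pulls_def)
  then have "(\<Sum>j\<in>{j\<in>{1..n}. v j = a}. w j) = 0" by (simp only: sum.empty)
  with True show ?thesis by simp
qed (simp add: arm_mean_def)

text \<open>A statement about a single path: the average is a mixture of the two empirical means,
  weighted by the pull frequencies. For distinct limits the comparison in the rule is eventually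
  constant, so the frequency of the better arm is steered to \<open>\<gamma>\<close>.\<close>

lemma average_tendsto_gamma_rule:
  fixes \<mu>L \<mu>R :: real
  assumes rule: "\<And>k. v k = gamma_rule \<gamma> wL wR v k" and \<gamma>: "0 \<le> \<gamma>" "\<gamma> \<le> 1"
    and L: "arm_mean wL v 1 \<longlonglongrightarrow> \<mu>L" and R: "arm_mean wR v 2 \<longlonglongrightarrow> \<mu>R"
  shows "(\<lambda>n. (\<Sum>i=1..n. if v i = 1 then wL i else wR i) / real n) \<longlonglongrightarrow>
    \<gamma> * max \<mu>L \<mu>R + (1 - \<gamma>) * min \<mu>L \<mu>R"
proof -
  let ?p = "\<lambda>a n. real (pulls v a n) / real n"
  have v12: "v k = 1 \<or> v k = 2" for k
    using gamma_rule_cases[of \<gamma> wL wR v k] rule[of k] by simp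
  have total: "pulls v 1 n + pulls v 2 n = n" for n
  proof -
    have "pulls v 1 n + pulls v 2 n = (\<Sum>j=1..n. 1)"
      unfolding pulls_eq_sum sum.distrib[symmetric]
      by (intro sum.cong refl) (use v12 in force)
    then show ?thesis by simp
  qed
  have sum1: "?p 1 n + ?p 2 n = 1" if "0 < n" for n
  proof -
    have "?p 1 n + ?p 2 n = real (pulls v 1 n + pulls v 2 n) / real n"
      by (simp add: add_divide_distrib)
    then show ?thesis using that total[of n] by simp
  qed
  have split: "(\<Sum>i=1..n. if v i = 1 then wL i else wR i) / real n =
      ?p 1 n * arm_mean wL v 1 n + ?p 2 n * arm_mean wR v 2 n" for n
  proof -
    have "(\<Sum>i=1..n. if v i = 1 then wL i else wR i) =
        (\<Sum>j\<in>{j\<in>{1..n}. v j = 1}. wL j) + (\<Sum>j\<in>{j\<in>{1..n}. v j = 2}. wR j)"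
      unfolding sum.inter_filter[OF finite_atLeastAtMost] sum.distrib[symmetric]
      by (intro sum.cong refl) (use v12 in force)
    then show ?thesis
      by (simp only: arm_mean_times_pulls[symmetric] add_divide_distrib times_divide_eq_left)
  qed
  \<comment> \<open>Here \<open>a\<close> is the better arm and \<open>3 - a\<close> the other
    one.\<close>
  have mix: ?thesis if "?p a \<longlonglongrightarrow> \<gamma>" "a \<in> {1, 2}"
    "(if a = 1 then \<mu>L else \<mu>R) = max \<mu>L \<mu>R" "(if a = 1 then \<mu>R else \<mu>L) = min \<mu>L \<mu>R" for a
  proof -
    have "(\<lambda>n. 1 - ?p a n) \<longlonglongrightarrow> 1 - \<gamma>"
      by (intro tendsto_intros that)
    then have "?p (3 - a) \<longlonglongrightarrow> 1 - \<gamma>"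
    proof (rule Lim_transform_eventually)
      show "\<forall>\<^sub>F n in sequentially. 1 - ?p a n = ?p (3 - a) n"
        using eventually_gt_at_top[of 0]
      proof eventually_elim
        case (elim n)
        then show ?case using sum1[OF elim] that(2) by (auto simp: eval_nat_numeral)
      qed
    qed
    then have "?p 1 \<longlonglongrightarrow> (if a = 1 then \<gamma> else 1 - \<gamma>)" "?p 2 \<longlonglongrightarrow> (if a = 1 then 1 - \<gamma> else \<gamma>)"
      using that(1,2) by (auto simp: eval_nat_numeral)
    from tendsto_add[OF tendsto_mult[OF this(1) L] tendsto_mult[OF this(2) R]]
    show ?thesis
      unfolding split using that(2-) by (auto simp: algebra_simps split: if_splits)
  qed
  show ?thesis
  proof (cases \<mu>L \<mu>R rule: linorder_cases)
    case less
    have "\<forall>\<^sub>F k in sequentially. arm_mean wL v 1 k < arm_mean wR v 2 k"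
    proof -
      obtain m where "\<mu>L < m" "m < \<mu>R" using dense[OF less] by blast
      from order_tendstoD(2)[OF L this(1)] order_tendstoD(1)[OF R this(2)]
      show ?thesis by eventually_elim simp
    qed
    then have "\<forall>\<^sub>F k in sequentially. arm_mean wL v 1 (k - 1) < arm_mean wR v 2 (k - 1)"
      by (rule eventually_compose_filterlim[OF _ filterlim_minus_const_nat_at_top])
    then have "?p 2 \<longlonglongrightarrow> \<gamma>"
      by (intro pulls_fraction_tendsto \<gamma>, elim eventually_mono)
        (subst rule, auto simp: gamma_rule_unscheduled)
    then show ?thesis using less by (intro mix[of 2]) auto
  next
    case greater
    have "\<forall>\<^sub>F k in sequentially. arm_mean wL v 1 k > arm_mean wR v 2 k"
    proof -
      obtain m where "\<mu>R < m" "m < \<mu>L" using dense[OF greater] by blast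
      from order_tendstoD(2)[OF R this(1)] order_tendstoD(1)[OF L this(2)]
      show ?thesis by eventually_elim simp
    qed
    then have "\<forall>\<^sub>F k in sequentially. arm_mean wL v 1 (k - 1) > arm_mean wR v 2 (k - 1)"
      by (rule eventually_compose_filterlim[OF _ filterlim_minus_const_nat_at_top])
    then have "?p 1 \<longlonglongrightarrow> \<gamma>"
      by (intro pulls_fraction_tendsto \<gamma>, elim eventually_mono)
        (subst rule, auto simp: gamma_rule_unscheduled)
    then show ?thesis using greater by (intro mix[of 1]) auto
  next
    case equal
    \<comment> \<open>With equal limits the comparison may never settle. Only the bounds on the
      frequencies and their sum 1 are used; their convergence is not.\<close>
    have p: "0 \<le> ?p a n" "?p a n \<le> 1" for a n
    proof -
      have "pulls v a n \<le> card {1..n}"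
        unfolding pulls_def by (intro card_mono) auto
      then show "0 \<le> ?p a n" "?p a n \<le> 1" by (auto simp: divide_le_eq_1)
    qed
    have small: "(\<lambda>n. ?p a n * (m n - \<mu>L)) \<longlonglongrightarrow> 0" if "m \<longlonglongrightarrow> \<mu>L" for a m
    proof (rule Lim_null_comparison)
      show "\<forall>\<^sub>F n in sequentially. norm (?p a n * (m n - \<mu>L)) \<le> \<bar>m n - \<mu>L\<bar>"
      proof (intro always_eventually allI)
        fix n
        have "?p a n * \<bar>m n - \<mu>L\<bar> \<le> 1 * \<bar>m n - \<mu>L\<bar>"
          by (intro mult_right_mono p) simp
        then show "norm (?p a n * (m n - \<mu>L)) \<le> \<bar>m n - \<mu>L\<bar>"
          by (simp add: abs_mult)
      qed
      show "(\<lambda>n. \<bar>m n - \<mu>L\<bar>) \<longlonglongrightarrow> 0"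
        using that by (simp add: LIM_zero_iff tendsto_rabs_zero_iff)
    qed
    have "(\<lambda>n. \<mu>L + (?p 1 n * (arm_mean wL v 1 n - \<mu>L) + ?p 2 n * (arm_mean wR v 2 n - \<mu>L))) \<longlonglongrightarrow> \<mu>L + (0 + 0)"
      using L R equal by (intro tendsto_intros small) auto
    then have "(\<lambda>n. (\<Sum>i=1..n. if v i = 1 then wL i else wR i) / real n) \<longlonglongrightarrow> \<mu>L + (0 + 0)"
    proof (rule Lim_transform_eventually)
      show "\<forall>\<^sub>F n in sequentially. \<mu>L + (?p 1 n * (arm_mean wL v 1 n - \<mu>L) + ?p 2 n * (arm_mean wR v 2 n - \<mu>L)) =
          (\<Sum>i=1..n. if v i = 1 then wL i else wR i) / real n"
        using eventually_gt_at_top[of 0]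
      proof eventually_elim
        case (elim n)
        define p q A C where "p = ?p 1 n" and "q = ?p 2 n" and "A = arm_mean wL v 1 n" and "C = arm_mean wR v 2 n"
        have q: "q = 1 - p" using sum1[OF elim] by (simp add: p_def q_def)
        have "\<mu>L + (p * (A - \<mu>L) + q * (C - \<mu>L)) = p * A + q * C"
          unfolding q by (simp add: algebra_simps)
        then show ?case unfolding split p_def q_def A_def C_def .
      qed
    qed
    then show ?thesis using equal by (simp add: algebra_simps)
  qed
qed

section \<open>The two-armed bandit\<close>

lemma history_eq_sigma_gen: "history M WL WR \<theta> n = sigma_gen M (reward WL WR \<theta>) {1..n}"
  unfolding history_def sigma_gen_def by (rule arg_cong[where f = "sigma (space M)"]) blast

lemma measurable_count_space_UNIV:
  "f \<in> measurable N (count_space A) \<Longrightarrow> f \<in> measurable N (count_space UNIV)"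
  using measurable_compose[of f N "count_space A" "\<lambda>x. x" "count_space UNIV"] by simp

lemma measurable_sigma_gen_mono:
  assumes "f \<in> measurable (sigma_gen M Z K) N" "K \<subseteq> K'"
  shows "f \<in> measurable (sigma_gen M Z K') N"
  using assms sigma_gen_mono[OF assms(2), of M Z] by (auto simp: measurable_def)

definition arms :: "(nat \<Rightarrow> 'a \<Rightarrow> real) \<Rightarrow> (nat \<Rightarrow> 'a \<Rightarrow> real) \<Rightarrow> bool \<times> nat \<Rightarrow> 'a \<Rightarrow> real"
  where "arms WL WR = (\<lambda>(b, i). if b then WL i else WR i)"

text \<open>Contains the rewards of both arms, also those a strategy never sees, and does not depend
  on the strategy.\<close>

definition full_history :: "'a measure \<Rightarrow> (nat \<Rightarrow> 'a \<Rightarrow> real) \<Rightarrow> (nat \<Rightarrow> 'a \<Rightarrow> real) \<Rightarrow> nat \<Rightarrow> 'a measure"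
  where "full_history M WL WR n = sigma_gen M (arms WL WR) (UNIV \<times> {1..n})"

lemma measurable_reward:
  assumes "WL i \<in> borel_measurable N" "WR i \<in> borel_measurable N"
    and "\<theta> i \<in> measurable N (count_space UNIV)"
  shows "reward WL WR \<theta> i \<in> borel_measurable N"
proof -
  note [measurable] = assms
  have "reward WL WR \<theta> i = (\<lambda>\<omega>. if \<theta> i \<omega> = 1 then WL i \<omega> else WR i \<omega>)"
    by (simp add: reward_def fun_eq_iff)
  then show ?thesis by simp
qed

text \<open>The observed rewards depend on earlier choices, so this is a strong induction: once the
  choices before \<open>j\<close> are known to be measurable, so are the rewards before
  \<open>j\<close>, and \<open>history\<close> lies inside \<open>full_history\<close>.\<close>

lemma admissible_predictable:
  assumes \<theta>: "\<theta> \<in> admissible_strategies M WL WR" and "1 \<le> j"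
  shows "\<theta> j \<in> measurable (full_history M WL WR (j - 1)) (count_space UNIV)"
  using \<open>1 \<le> j\<close>
proof (induction j rule: less_induct)
  case (less j)
  have "reward WL WR \<theta> i \<in> borel_measurable (full_history M WL WR (j - 1))" if i: "i \<in> {1..j - 1}" for i
  proof (rule measurable_reward)
    show "WL i \<in> borel_measurable (full_history M WL WR (j - 1))"
      using measurable_sigma_gen[of "(True, i)" "UNIV \<times> {1..j - 1}" "arms WL WR" M] i
      by (simp add: arms_def full_history_def)
    show "WR i \<in> borel_measurable (full_history M WL WR (j - 1))"
      using measurable_sigma_gen[of "(False, i)" "UNIV \<times> {1..j - 1}" "arms WL WR" M] i
      by (simp add: arms_def full_history_def)
    have "\<theta> i \<in> measurable (full_history M WL WR (i - 1)) (count_space UNIV)"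
      using i by (intro less.IH) auto
    then show "\<theta> i \<in> measurable (full_history M WL WR (j - 1)) (count_space UNIV)"
      unfolding full_history_def by (rule measurable_sigma_gen_mono) (use i in auto)
  qed
  then have "subalgebra (full_history M WL WR (j - 1)) (history M WL WR \<theta> (j - 1))"
    unfolding history_eq_sigma_gen by (intro subalgebra_sigma_gen) (simp_all add: full_history_def)
  moreover have "\<theta> j \<in> measurable (history M WL WR \<theta> (j - 1)) (count_space UNIV)"
    using \<theta> less.prems unfolding admissible_strategies_def by (auto intro: measurable_count_space_UNIV)
  ultimately show ?case by (rule measurable_from_subalg)
qed

section \<open>Admissibility of the strategy\<close>

lemma gamma_strategy_rule:
  "gamma_strategy WL WR \<gamma> k \<omega> =
    gamma_rule \<gamma> (\<lambda>i. WL i \<omega>) (\<lambda>i. WR i \<omega>) (\<lambda>j. gamma_strategy WL WR \<gamma> j \<omega>) k"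
  unfolding gamma_strategy_def using gamma_path_rec by metis

text \<open>The rule is written in terms of \<open>WL\<close> and \<open>WR\<close>, which the
  history does not contain. But an empirical mean only sums over rounds that pulled its arm, and
  there the value is the observed reward.\<close>

lemma gamma_strategy_predictable:
  assumes "1 \<le> k"
  shows "gamma_strategy WL WR \<gamma> k \<in>
    measurable (history M WL WR (gamma_strategy WL WR \<gamma>) (k - 1)) (count_space UNIV)"
  using assms
proof (induction k rule: less_induct)
  case (less k)
  let ?\<theta> = "gamma_strategy WL WR \<gamma>"
  let ?H = "\<lambda>n. history M WL WR ?\<theta> n"
  have \<theta> [measurable]: "?\<theta> j \<in> measurable (?H (k - 1)) (count_space UNIV)" if "j \<in> {1..k - 1}" for j
  proof -
    have "?\<theta> j \<in> measurable (?H (j - 1)) (count_space UNIV)"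
      using that by (intro less.IH) auto
    then show ?thesis
      unfolding history_eq_sigma_gen by (rule measurable_sigma_gen_mono) (use that in auto)
  qed
  have [measurable]: "reward WL WR ?\<theta> j \<in> borel_measurable (?H (k - 1))" if "j \<in> {1..k - 1}" for j
    unfolding history_eq_sigma_gen using that by (rule measurable_sigma_gen)
  have [measurable]: "(\<lambda>\<omega>. pulls (\<lambda>j. ?\<theta> j \<omega>) a (k - 1)) \<in> measurable (?H (k - 1)) (count_space UNIV)" for a
    by (intro measurable_pulls \<theta>)
  have mean: "(\<lambda>\<omega>. arm_mean (\<lambda>i. w i \<omega>) (\<lambda>j. ?\<theta> j \<omega>) a (k - 1)) \<in> borel_measurable (?H (k - 1))"
    if w: "\<And>j \<omega>. ?\<theta> j \<omega> = a \<Longrightarrow> w j \<omega> = reward WL WR ?\<theta> j \<omega>" for w and a :: nat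
  proof -
    have "arm_mean (\<lambda>i. w i \<omega>) (\<lambda>j. ?\<theta> j \<omega>) a (k - 1) =
        (\<Sum>j=1..k - 1. if ?\<theta> j \<omega> = a then reward WL WR ?\<theta> j \<omega> else 0) /
          real (pulls (\<lambda>j. ?\<theta> j \<omega>) a (k - 1))" for \<omega>
      unfolding arm_mean_def sum.inter_filter[OF finite_atLeastAtMost]
      by (intro arg_cong2[where f = "(/)"] sum.cong refl) (simp add: w)
    then show ?thesis by (simp only:) measurable
  qed
  have [measurable]:
    "(\<lambda>\<omega>. arm_mean (\<lambda>i. WL i \<omega>) (\<lambda>j. ?\<theta> j \<omega>) 1 (k - 1)) \<in> borel_measurable (?H (k - 1))"
    "(\<lambda>\<omega>. arm_mean (\<lambda>i. WR i \<omega>) (\<lambda>j. ?\<theta> j \<omega>) 2 (k - 1)) \<in> borel_measurable (?H (k - 1))"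
    by (rule mean; simp add: reward_def)+
  have "?\<theta> k = (\<lambda>\<omega>. gamma_rule \<gamma> (\<lambda>i. WL i \<omega>) (\<lambda>i. WR i \<omega>) (\<lambda>j. ?\<theta> j \<omega>) k)"
    by (rule ext) (rule gamma_strategy_rule)
  then show ?case
    unfolding gamma_rule_def by (simp only:) measurable
qed

lemma gamma_strategy_range: "gamma_strategy WL WR \<gamma> k \<omega> \<in> {1, 2}"
  unfolding gamma_strategy_rule[of WL WR \<gamma> k \<omega>] using gamma_rule_cases by blast

lemma measurable_count_space_subset:
  assumes "f \<in> measurable N (count_space UNIV)" "\<And>x. f x \<in> A"
  shows "f \<in> measurable N (count_space A)"
  using assms by (auto simp: measurable_def)

lemma (in prob_space) gamma_strategy_admissible:
  assumes "\<And>i. 1 \<le> i \<Longrightarrow> WL i \<in> borel_measurable M" "\<And>i. 1 \<le> i \<Longrightarrow> WR i \<in> borel_measurable M"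
  shows "gamma_strategy WL WR \<gamma> \<in> admissible_strategies M WL WR"
proof -
  let ?\<theta> = "gamma_strategy WL WR \<gamma>"
  \<comment> \<open>Another induction: the history is a sub-sigma-algebra of \<open>M\<close> only
    once the earlier choices are known to be measurable.\<close>
  have M: "?\<theta> n \<in> measurable M (count_space UNIV)" if "1 \<le> n" for n
    using that
  proof (induction n rule: less_induct)
    case (less n)
    have "subalgebra M (history M WL WR ?\<theta> (n - 1))"
      unfolding history_eq_sigma_gen
      using less.IH by (intro subalgebra_sigma_gen measurable_reward assms) auto
    then show ?case
      using gamma_strategy_predictable[OF less.prems] by (rule measurable_from_subalg)
  qed
  note M [THEN measurable_count_space_subset, OF _ gamma_strategy_range]
    gamma_strategy_predictable [THEN measurable_count_space_subset, OF _ gamma_strategy_range]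
  then show ?thesis
    unfolding admissible_strategies_def sampling_strategy_def mem_Collect_eq by blast
qed

lemma integral_copy:
  fixes X W :: "'a \<Rightarrow> real" and f :: "real \<Rightarrow> real"
  assumes eq: "distr M borel X = distr M borel W"
    and [measurable]: "X \<in> borel_measurable M" "W \<in> borel_measurable M" "f \<in> borel_measurable borel"
  shows "integrable M (\<lambda>\<omega>. f (X \<omega>)) \<longleftrightarrow> integrable M (\<lambda>\<omega>. f (W \<omega>))"
    and "(\<integral>\<omega>. f (X \<omega>) \<partial>M) = (\<integral>\<omega>. f (W \<omega>) \<partial>M)"
proof -
  show "integrable M (\<lambda>\<omega>. f (X \<omega>)) \<longleftrightarrow> integrable M (\<lambda>\<omega>. f (W \<omega>))"
    using integrable_distr_eq[of X M borel f] integrable_distr_eq[of W M borel f] eq by simp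
  show "(\<integral>\<omega>. f (X \<omega>) \<partial>M) = (\<integral>\<omega>. f (W \<omega>) \<partial>M)"
    using integral_distr[of X M borel f] integral_distr[of W M borel f] eq by simp
qed

text \<open>The index \<open>(b, n)\<close> lies outside \<open>UNIV \<times> {1..n - 1}\<close>, so
  the new reward is independent of everything either arm has produced before. The moments are
  carried over from \<open>W\<close> through equality of laws.\<close>

lemma (in prob_space) noise_arm:
  fixes W :: "'a \<Rightarrow> real"
  assumes indep: "indep_vars (\<lambda>_. borel) (arms WL WR) (UNIV \<times> {1..})"
    and W: "integrable M W" "integrable M (\<lambda>\<omega>. (W \<omega> - expectation W)\<^sup>2)"
    and copy: "\<And>i. 1 \<le> i \<Longrightarrow> distr M borel (arms WL WR (b, i)) = distr M borel W"
  shows "noise M (full_history M WL WR) (\<lambda>n \<omega>. arms WL WR (b, n) \<omega> - expectation W)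
    (expectation (\<lambda>\<omega>. (W \<omega> - expectation W)\<^sup>2))"
proof
  let ?Z = "arms WL WR" and ?\<mu> = "expectation W"
  have Z: "?Z (c, i) \<in> borel_measurable M" if "1 \<le> i" for c i
    using indep that by (auto simp: indep_vars_def2)
  have [measurable]: "W \<in> borel_measurable M" using W by simp
  show "subalgebra M (full_history M WL WR n)" for n
    unfolding full_history_def by (intro subalgebra_sigma_gen) (auto intro: Z)
  show "sets (full_history M WL WR m) \<subseteq> sets (full_history M WL WR n)" if "m \<le> n" for m n
    unfolding full_history_def using that by (intro sigma_gen_mono) auto
  fix n :: nat assume n: "1 \<le> n"
  have "?Z (b, n) \<in> borel_measurable (full_history M WL WR n)"
    unfolding full_history_def using n by (intro measurable_sigma_gen) auto
  then show "(\<lambda>\<omega>. ?Z (b, n) \<omega> - ?\<mu>) \<in> borel_measurable (full_history M WL WR n)"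
    by simp
  show "indep_var borel (\<lambda>\<omega>. ?Z (b, n) \<omega> - ?\<mu>) borel g"
    if "g \<in> borel_measurable (full_history M WL WR (n - 1))" for g
  proof -
    have "indep_var borel (?Z (b, n)) borel g"
      using n that unfolding full_history_def by (intro indep_var_sigma_gen[OF indep]) auto
    then have "indep_var borel ((\<lambda>t. t - ?\<mu>) \<circ> ?Z (b, n)) borel ((\<lambda>t. t) \<circ> g)"
      by (rule indep_var_compose) simp_all
    then show ?thesis by (simp add: comp_def)
  qed
  note c = integral_copy[OF copy[OF n] Z[OF n] \<open>W \<in> borel_measurable M\<close>]
  show "integrable M (\<lambda>\<omega>. (?Z (b, n) \<omega> - ?\<mu>)\<^sup>2)"
    using c(1)[of "\<lambda>t. (t - ?\<mu>)\<^sup>2"] W by simp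
  show "expectation (\<lambda>\<omega>. ?Z (b, n) \<omega> - ?\<mu>) = 0"
    using c(2)[of "\<lambda>t. t - ?\<mu>"] W by (simp add: prob_space)
  show "expectation (\<lambda>\<omega>. (?Z (b, n) \<omega> - ?\<mu>)\<^sup>2) = expectation (\<lambda>\<omega>. (W \<omega> - ?\<mu>)\<^sup>2)"
    using c(2)[of "\<lambda>t. (t - ?\<mu>)\<^sup>2"] by simp
qed

text \<open>Centring commutes with averaging only once the arm has been pulled, which
  \<open>N\<close> guarantees from then on.\<close>

lemma arm_mean_tendsto:
  assumes lim: "(\<lambda>n. (\<Sum>j\<in>{j\<in>{1..n}. v j = a}. w j - \<mu>) / real (pulls v a n)) \<longlonglongrightarrow> 0"
    and "1 \<le> pulls v a N"
  shows "arm_mean w v a \<longlonglongrightarrow> \<mu>"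
proof (rule Lim_transform_eventually)
  show "(\<lambda>n. (\<Sum>j\<in>{j\<in>{1..n}. v j = a}. w j - \<mu>) / real (pulls v a n) + \<mu>) \<longlonglongrightarrow> \<mu>"
    using tendsto_add[OF lim tendsto_const] by simp
  show "\<forall>\<^sub>F n in sequentially.
      (\<Sum>j\<in>{j\<in>{1..n}. v j = a}. w j - \<mu>) / real (pulls v a n) + \<mu> = arm_mean w v a n"
    using eventually_ge_at_top[of N]
  proof eventually_elim
    case (elim n)
    then have "0 < pulls v a n" using pulls_mono[OF elim, of v a] \<open>1 \<le> pulls v a N\<close> by simp
    moreover have "(\<Sum>j\<in>{j\<in>{1..n}. v j = a}. w j - \<mu>) =
        (\<Sum>j\<in>{j\<in>{1..n}. v j = a}. w j) - real (pulls v a n) * \<mu>"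
      by (simp add: sum_subtractf pulls_def)
    ultimately show ?case
      by (simp add: arm_mean_def diff_divide_distrib)
  qed
qed

text \<open>Dominated convergence for the indicators of these events, each eventually 1 on almost
  every path.\<close>

lemma (in prob_space) prob_near_limit_tendsto_1:
  fixes f :: "nat \<Rightarrow> 'a \<Rightarrow> real"
  assumes [measurable]: "\<And>n. f n \<in> borel_measurable M"
    and lim: "AE \<omega> in M. (\<lambda>n. f n \<omega>) \<longlonglongrightarrow> h" and "0 < \<epsilon>"
  shows "(\<lambda>n. prob {\<omega> \<in> space M. \<bar>f n \<omega> - h\<bar> < \<epsilon>}) \<longlonglongrightarrow> 1"
proof -
  have "(\<lambda>n. expectation (\<lambda>\<omega>. indicator {\<omega> \<in> space M. \<bar>f n \<omega> - h\<bar> < \<epsilon>} \<omega>)) \<longlonglongrightarrow> expectation (\<lambda>\<omega>. 1 :: real)"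
  proof (rule integral_dominated_convergence[where w = "\<lambda>_. 1"])
    show "AE \<omega> in M. (\<lambda>n. indicator {\<omega> \<in> space M. \<bar>f n \<omega> - h\<bar> < \<epsilon>} \<omega> :: real) \<longlonglongrightarrow> 1"
      using lim AE_space
    proof eventually_elim
      case (elim \<omega>)
      have "\<forall>\<^sub>F n in sequentially. dist (f n \<omega>) h < \<epsilon>"
        using elim(1) \<open>0 < \<epsilon>\<close> by (rule tendstoD)
      then have "\<forall>\<^sub>F n in sequentially. indicator {\<omega> \<in> space M. \<bar>f n \<omega> - h\<bar> < \<epsilon>} \<omega> = (1 :: real)"
        by eventually_elim (use elim(2) in \<open>simp add: dist_real_def\<close>)
      then show ?case by (rule tendsto_eventually)
    qed
  qed (auto simp: indicator_def)
  then show ?thesis by (simp add: prob_space)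
qed

section \<open>Weak and strong law for the bandit\<close>

lemma measurable_total_reward:
  assumes "\<And>i. 1 \<le> i \<Longrightarrow> WL i \<in> borel_measurable M" "\<And>i. 1 \<le> i \<Longrightarrow> WR i \<in> borel_measurable M"
    and "\<theta> \<in> admissible_strategies M WL WR"
  shows "total_reward WL WR \<theta> n \<in> borel_measurable M"
proof -
  have "(\<lambda>\<omega>. \<Sum>i=1..n. reward WL WR \<theta> i \<omega>) \<in> borel_measurable M"
    using assms unfolding admissible_strategies_def sampling_strategy_def
    by (intro borel_measurable_sum measurable_reward) (auto intro: measurable_count_space_UNIV)
  then show ?thesis by (simp add: total_reward_def[abs_def])
qed

text \<open>The average reward is \<open>DL + DR\<close> plus an average of true means, and the
  latter always lies between \<open>min \<mu>L \<mu>R\<close> and \<open>max \<mu>L \<mu>R\<close>.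
  Each noise term gets half of \<open>\<epsilon>\<close>, which is where the 4 comes from. The bound
  does not involve \<open>\<theta>\<close>.\<close>

lemma (in prob_space) total_reward_weak_law:
  assumes NL: "noise M (full_history M WL WR) (\<lambda>n \<omega>. WL n \<omega> - \<mu>L) vL"
    and NR: "noise M (full_history M WL WR) (\<lambda>n \<omega>. WR n \<omega> - \<mu>R) vR"
    and \<theta>: "\<theta> \<in> admissible_strategies M WL WR"
    and meas: "total_reward WL WR \<theta> n \<in> borel_measurable M"
    and "0 < \<epsilon>" "0 < n"
  shows "1 - 4 * (vL + vR) / (\<epsilon>\<^sup>2 * real n) \<le> prob {\<omega> \<in> space M.
    min \<mu>L \<mu>R - \<epsilon> < total_reward WL WR \<theta> n \<omega> / real n \<and> total_reward WL WR \<theta> n \<omega> / real n < max \<mu>L \<mu>R + \<epsilon>}"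
proof -
  interpret L: noise M "full_history M WL WR" "\<lambda>n \<omega>. WL n \<omega> - \<mu>L" vL by (rule NL)
  interpret R: noise M "full_history M WL WR" "\<lambda>n \<omega>. WR n \<omega> - \<mu>R" vR by (rule NR)
  note \<theta>_pred = admissible_predictable[OF \<theta>]
  define DL where "DL \<omega> = (\<Sum>j=1..n. of_bool (\<theta> j \<omega> = 1) * (WL j \<omega> - \<mu>L)) / real n" for \<omega>
  define DR where "DR \<omega> = (\<Sum>j=1..n. of_bool (\<theta> j \<omega> = 2) * (WR j \<omega> - \<mu>R)) / real n" for \<omega>
  define bad where "bad D = {\<omega> \<in> space M. \<epsilon> / 2 \<le> \<bar>D \<omega>\<bar>}" for D :: "'a \<Rightarrow> real"
  note [measurable] = meas
  have \<theta>_meas: "\<theta> j \<in> measurable M (count_space UNIV)" if "1 \<le> j" for j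
    using L.measurable_F_M[OF \<theta>_pred[OF that]] .
  have DL_meas [measurable]: "DL \<in> borel_measurable M"
  proof -
    have "(\<lambda>\<omega>. of_bool (\<theta> j \<omega> = 1) * (WL j \<omega> - \<mu>L)) \<in> borel_measurable M" if "j \<in> {1..n}" for j
    proof -
      have [measurable]: "\<theta> j \<in> measurable M (count_space UNIV)" "(\<lambda>\<omega>. WL j \<omega> - \<mu>L) \<in> borel_measurable M"
        using that \<theta>_meas L.noise_measurable by auto
      show ?thesis by measurable
    qed
    then show ?thesis unfolding DL_def by (intro borel_measurable_divide borel_measurable_sum) auto
  qed
  have DR_meas [measurable]: "DR \<in> borel_measurable M"
  proof -
    have "(\<lambda>\<omega>. of_bool (\<theta> j \<omega> = 2) * (WR j \<omega> - \<mu>R)) \<in> borel_measurable M" if "j \<in> {1..n}" for j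
    proof -
      have [measurable]: "\<theta> j \<in> measurable M (count_space UNIV)" "(\<lambda>\<omega>. WR j \<omega> - \<mu>R) \<in> borel_measurable M"
        using that \<theta>_meas R.noise_measurable by auto
      show ?thesis by measurable
    qed
    then show ?thesis unfolding DR_def by (intro borel_measurable_divide borel_measurable_sum) auto
  qed
  have PL: "prob (bad DL) \<le> vL / ((\<epsilon> / 2)\<^sup>2 * real n)"
    unfolding bad_def DL_def by (rule L.pulled_noise_weak_law) (use \<theta>_pred \<open>0 < \<epsilon>\<close> \<open>0 < n\<close> in auto)
  have PR: "prob (bad DR) \<le> vR / ((\<epsilon> / 2)\<^sup>2 * real n)"
    unfolding bad_def DR_def by (rule R.pulled_noise_weak_law) (use \<theta>_pred \<open>0 < \<epsilon>\<close> \<open>0 < n\<close> in auto)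
  let ?good = "{\<omega> \<in> space M. min \<mu>L \<mu>R - \<epsilon> < total_reward WL WR \<theta> n \<omega> / real n \<and>
      total_reward WL WR \<theta> n \<omega> / real n < max \<mu>L \<mu>R + \<epsilon>}"
  have "space M - (bad DL \<union> bad DR) \<subseteq> ?good"
  proof
    fix \<omega> assume \<omega>: "\<omega> \<in> space M - (bad DL \<union> bad DR)"
    define m where "m j = (if \<theta> j \<omega> = 1 then \<mu>L else \<mu>R)" for j
    have \<theta>12: "\<theta> j \<omega> = 1 \<or> \<theta> j \<omega> = 2" if "1 \<le> j" for j
      using \<theta> that \<omega> unfolding admissible_strategies_def sampling_strategy_def
      by (auto dest!: spec[of _ j] measurable_space)
    have "total_reward WL WR \<theta> n \<omega> = (\<Sum>j=1..n. of_bool (\<theta> j \<omega> = 1) * (WL j \<omega> - \<mu>L) +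
        of_bool (\<theta> j \<omega> = 2) * (WR j \<omega> - \<mu>R) + m j)"
      unfolding total_reward_def using \<theta>12 by (intro sum.cong) (force simp: reward_def m_def)+
    then have S: "total_reward WL WR \<theta> n \<omega> / real n = DL \<omega> + DR \<omega> + (\<Sum>j=1..n. m j) / real n"
      by (simp add: sum.distrib DL_def DR_def add_divide_distrib)
    have "real n * min \<mu>L \<mu>R \<le> (\<Sum>j=1..n. m j)"
      using sum_bounded_below[of "{1..n}" "min \<mu>L \<mu>R" m] by (simp add: m_def)
    then have "min \<mu>L \<mu>R \<le> (\<Sum>j=1..n. m j) / real n"
      using \<open>0 < n\<close> by (simp add: pos_le_divide_eq mult.commute)
    moreover have "(\<Sum>j=1..n. m j) \<le> real n * max \<mu>L \<mu>R"
      using sum_bounded_above[of "{1..n}" m "max \<mu>L \<mu>R"] by (simp add: m_def)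
    then have "(\<Sum>j=1..n. m j) / real n \<le> max \<mu>L \<mu>R"
      using \<open>0 < n\<close> by (simp add: pos_divide_le_eq mult.commute)
    moreover have "\<bar>DL \<omega>\<bar> < \<epsilon> / 2" "\<bar>DR \<omega>\<bar> < \<epsilon> / 2"
      using \<omega> by (auto simp: bad_def)
    ultimately show "\<omega> \<in> ?good"
      using \<omega> unfolding S mem_Collect_eq by (intro conjI; linarith?) simp
  qed
  then have "prob (space M - (bad DL \<union> bad DR)) \<le> prob ?good"
    by (intro finite_measure_mono) measurable
  moreover have "prob (space M - (bad DL \<union> bad DR)) = 1 - prob (bad DL \<union> bad DR)"
    by (rule prob_compl) (simp add: bad_def)
  moreover have "prob (bad DL \<union> bad DR) \<le> prob (bad DL) + prob (bad DR)"
    by (rule measure_Un_le) (simp_all add: bad_def)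
  moreover have "vL / ((\<epsilon> / 2)\<^sup>2 * real n) + vR / ((\<epsilon> / 2)\<^sup>2 * real n) = 4 * (vL + vR) / (\<epsilon>\<^sup>2 * real n)"
    by (simp add: power_divide add_divide_distrib[symmetric] mult.commute distrib_left)
  ultimately show ?thesis using PL PR by linarith
qed

lemma (in prob_space) gamma_strategy_strong_law:
  assumes NL: "noise M (full_history M WL WR) (\<lambda>n \<omega>. WL n \<omega> - \<mu>L) vL"
    and NR: "noise M (full_history M WL WR) (\<lambda>n \<omega>. WR n \<omega> - \<mu>R) vR"
    and \<theta>: "gamma_strategy WL WR \<gamma> \<in> admissible_strategies M WL WR"
    and \<gamma>: "0 \<le> \<gamma>" "\<gamma> \<le> 1"
  shows "AE \<omega> in M. (\<lambda>n. total_reward WL WR (gamma_strategy WL WR \<gamma>) n \<omega> / real n)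
    \<longlonglongrightarrow> \<gamma> * max \<mu>L \<mu>R + (1 - \<gamma>) * min \<mu>L \<mu>R"
proof -
  interpret L: noise M "full_history M WL WR" "\<lambda>n \<omega>. WL n \<omega> - \<mu>L" vL by (rule NL)
  interpret R: noise M "full_history M WL WR" "\<lambda>n \<omega>. WR n \<omega> - \<mu>R" vR by (rule NR)
  let ?v = "\<lambda>\<omega> j. gamma_strategy WL WR \<gamma> j \<omega>"
  note rule = gamma_strategy_rule[of WL WR \<gamma>]
  have many: "k \<le> pulls (?v \<omega>) a (2 ^ k)" if "a \<in> {1, 2}" for k a \<omega>
    using that by (intro le_pulls_gamma_rule[OF rule])
  have "AE \<omega> in M. (\<lambda>n. (\<Sum>j\<in>{j\<in>{1..n}. ?v \<omega> j = 1}. WL j \<omega> - \<mu>L) / real (pulls (?v \<omega>) 1 n)) \<longlonglongrightarrow> 0"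
    by (rule L.pulled_noise_mean_tendsto_0[where N = "\<lambda>k. 2 ^ k"])
      (use admissible_predictable[OF \<theta>] many in auto)
  moreover have "AE \<omega> in M. (\<lambda>n. (\<Sum>j\<in>{j\<in>{1..n}. ?v \<omega> j = 2}. WR j \<omega> - \<mu>R) / real (pulls (?v \<omega>) 2 n)) \<longlonglongrightarrow> 0"
    by (rule R.pulled_noise_mean_tendsto_0[where N = "\<lambda>k. 2 ^ k"])
      (use admissible_predictable[OF \<theta>] many in auto)
  ultimately show ?thesis
  proof eventually_elim
    case (elim \<omega>)
    \<comment> \<open>Both arms have been pulled by round 2: this is \<open>many\<close> at
      \<open>k = 1\<close>.\<close>
    have "arm_mean (\<lambda>i. WL i \<omega>) (?v \<omega>) 1 \<longlonglongrightarrow> \<mu>L"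
      using elim(1) many[of 1 1 \<omega>] by (intro arm_mean_tendsto[where N = 2]) auto
    moreover have "arm_mean (\<lambda>i. WR i \<omega>) (?v \<omega>) 2 \<longlonglongrightarrow> \<mu>R"
      using elim(2) many[of 2 1 \<omega>] by (intro arm_mean_tendsto[where N = 2]) auto
    ultimately show ?case
      unfolding total_reward_def reward_def
      by (intro average_tendsto_gamma_rule[OF rule \<gamma>])
  qed
qed

theorem theorem3p1:
  fixes M :: "'a measure"
    and W\<^sub>L W\<^sub>R :: "'a \<Rightarrow> real"
    and WL WR :: "nat \<Rightarrow> 'a \<Rightarrow> real"
    and \<mu>\<^sub>L \<mu>\<^sub>R \<mu>_max \<mu>_min :: real
  assumes "prob_space M"
    and "integrable M W\<^sub>L" and "integrable M W\<^sub>R"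
    and "\<mu>\<^sub>L = prob_space.expectation M W\<^sub>L" and "\<mu>\<^sub>R = prob_space.expectation M W\<^sub>R"
    and "integrable M (\<lambda>\<omega>. (W\<^sub>L \<omega> - \<mu>\<^sub>L)\<^sup>2)" and "integrable M (\<lambda>\<omega>. (W\<^sub>R \<omega> - \<mu>\<^sub>R)\<^sup>2)"
    and "prob_space.indep_vars M (\<lambda>_. borel) WL {1..}"
    and "prob_space.indep_vars M (\<lambda>_. borel) WR {1..}"
    and "\<And>i. i \<ge> 1 \<Longrightarrow> distr M borel (WL i) = distr M borel W\<^sub>L"
    and "\<And>i. i \<ge> 1 \<Longrightarrow> distr M borel (WR i) = distr M borel W\<^sub>R"
    and "prob_space.indep_var M
           (PiM {1..} (\<lambda>_. borel)) (\<lambda>\<omega>. \<lambda>i\<in>{1..}. WL i \<omega>)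
           (PiM {1..} (\<lambda>_. borel)) (\<lambda>\<omega>. \<lambda>i\<in>{1..}. WR i \<omega>)"
    and "\<mu>_max = max \<mu>\<^sub>L \<mu>\<^sub>R" and "\<mu>_min = min \<mu>\<^sub>L \<mu>\<^sub>R"
  shows
    "(\<forall>h\<in>{\<mu>_min..\<mu>_max}. \<forall>\<gamma>\<in>{0..1}. h = \<gamma> * \<mu>_max + (1 - \<gamma>) * \<mu>_min \<longrightarrow>
        gamma_strategy WL WR \<gamma> \<in> admissible_strategies M WL WR \<and>
        (AE \<omega> in M. (\<lambda>n. total_reward WL WR (gamma_strategy WL WR \<gamma>) n \<omega> / real n) \<longlonglongrightarrow> h))
     \<and>
     (\<forall>\<epsilon>>0. (\<lambda>n. INF \<theta>\<in>admissible_strategies M WL WR.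
        measure M {\<omega> \<in> space M. \<mu>_min - \<epsilon> < total_reward WL WR \<theta> n \<omega> / real n \<and>
                               total_reward WL WR \<theta> n \<omega> / real n < \<mu>_max + \<epsilon>}) \<longlonglongrightarrow> 1)
     \<and>
     (\<forall>\<epsilon>>0. \<forall>h\<in>{\<mu>_min..\<mu>_max}. (\<lambda>n. SUP \<theta>\<in>admissible_strategies M WL WR.
        measure M {\<omega> \<in> space M. \<bar>total_reward WL WR \<theta> n \<omega> / real n - h\<bar> < \<epsilon>}) \<longlonglongrightarrow> 1)"
proof -
  interpret prob_space M by fact
  note \<mu> = assms(4,5) and indep = assms(8,9,12) and \<mu>_max = assms(13) and \<mu>_min = assms(14)
  let ?\<Theta> = "admissible_strategies M WL WR"
  have WL: "WL i \<in> borel_measurable M" if "1 \<le> i" for i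
    using indep(1) that by (auto simp: indep_vars_def2)
  have WR: "WR i \<in> borel_measurable M" if "1 \<le> i" for i
    using indep(2) that by (auto simp: indep_vars_def2)
  note joint = indep_vars_pair_of_families[OF indep, folded arms_def]
  define vL where "vL = expectation (\<lambda>\<omega>. (W\<^sub>L \<omega> - \<mu>\<^sub>L)\<^sup>2)"
  define vR where "vR = expectation (\<lambda>\<omega>. (W\<^sub>R \<omega> - \<mu>\<^sub>R)\<^sup>2)"
  have NL: "noise M (full_history M WL WR) (\<lambda>n \<omega>. WL n \<omega> - \<mu>\<^sub>L) vL"
    using noise_arm[OF joint, of W\<^sub>L True] assms(2,6,10) by (simp add: arms_def \<mu> vL_def)
  have NR: "noise M (full_history M WL WR) (\<lambda>n \<omega>. WR n \<omega> - \<mu>\<^sub>R) vR"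
    using noise_arm[OF joint, of W\<^sub>R False] assms(3,7,11) by (simp add: arms_def \<mu> vR_def)
  have adm: "gamma_strategy WL WR \<gamma> \<in> ?\<Theta>" for \<gamma>
    by (intro gamma_strategy_admissible WL WR)
  have meas: "total_reward WL WR \<theta> n \<in> borel_measurable M" if "\<theta> \<in> ?\<Theta>" for \<theta> n
    using that by (intro measurable_total_reward WL WR)
  have strong: "AE \<omega> in M. (\<lambda>n. total_reward WL WR (gamma_strategy WL WR \<gamma>) n \<omega> / real n)
      \<longlonglongrightarrow> \<gamma> * \<mu>_max + (1 - \<gamma>) * \<mu>_min" if "\<gamma> \<in> {0..1}" for \<gamma>
    unfolding \<mu>_max \<mu>_min using that by (intro gamma_strategy_strong_law[OF NL NR adm]) auto
  have inf: "(\<lambda>n. INF \<theta>\<in>?\<Theta>. prob {\<omega> \<in> space M. \<mu>_min - \<epsilon> < total_reward WL WR \<theta> n \<omega> / real n \<and>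
      total_reward WL WR \<theta> n \<omega> / real n < \<mu>_max + \<epsilon>}) \<longlonglongrightarrow> 1" (is "(\<lambda>n. INF \<theta>\<in>_. ?p n \<theta>) \<longlonglongrightarrow> 1")
    if \<epsilon>: "0 < \<epsilon>" for \<epsilon>
  proof (rule tendsto_sandwich)
    show "\<forall>\<^sub>F n in sequentially. 1 - 4 * (vL + vR) / (\<epsilon>\<^sup>2 * real n) \<le> (INF \<theta>\<in>?\<Theta>. ?p n \<theta>)"
      using eventually_gt_at_top[of 0]
    proof eventually_elim
      case (elim n)
      then show ?case
        using adm \<epsilon> unfolding \<mu>_max \<mu>_min
        by (intro cINF_greatest total_reward_weak_law[OF NL NR] meas) auto
    qed
    \<comment> \<open>A real infimum is controlled only over a nonempty set bounded below;
      \<open>\<gamma> = 0\<close> is just a convenient admissible witness.\<close>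
    have "(INF \<theta>\<in>?\<Theta>. ?p n \<theta>) \<le> 1" for n
      by (rule order.trans[OF cINF_lower[OF _ adm[of 0]] prob_le_1]) (auto intro!: bdd_belowI[of _ 0])
    then show "\<forall>\<^sub>F n in sequentially. (INF \<theta>\<in>?\<Theta>. ?p n \<theta>) \<le> 1"
      by simp
    show "(\<lambda>n. 1 - 4 * (vL + vR) / (\<epsilon>\<^sup>2 * real n)) \<longlonglongrightarrow> 1"
      using \<epsilon> by real_asymp
  qed simp
  have sup: "(\<lambda>n. SUP \<theta>\<in>?\<Theta>. prob {\<omega> \<in> space M. \<bar>total_reward WL WR \<theta> n \<omega> / real n - h\<bar> < \<epsilon>}) \<longlonglongrightarrow> 1"
    (is "(\<lambda>n. SUP \<theta>\<in>_. ?p n \<theta>) \<longlonglongrightarrow> 1")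
    if \<epsilon>: "0 < \<epsilon>" and h: "h \<in> {\<mu>_min..\<mu>_max}" for \<epsilon> h
  proof -
    \<comment> \<open>Solves the convex combination for its weight. If the means coincide the weight
      is arbitrary, and 0 is chosen.\<close>
    obtain \<gamma> where \<gamma>: "\<gamma> \<in> {0..1}" "h = \<gamma> * \<mu>_max + (1 - \<gamma>) * \<mu>_min"
    proof (cases "\<mu>_max = \<mu>_min")
      case True
      then show ?thesis using h that[of 0] by simp
    next
      case False
      then have "\<mu>_min < \<mu>_max" using h by simp
      define \<gamma> where "\<gamma> = (h - \<mu>_min) / (\<mu>_max - \<mu>_min)"
      have "\<gamma> * (\<mu>_max - \<mu>_min) = h - \<mu>_min"
        using False by (simp add: \<gamma>_def)
      then have "h = \<gamma> * \<mu>_max + (1 - \<gamma>) * \<mu>_min"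
        by (simp add: algebra_simps)
      moreover have "\<gamma> \<in> {0..1}"
        using h \<open>\<mu>_min < \<mu>_max\<close> by (simp add: \<gamma>_def)
      ultimately show ?thesis by (rule that[rotated])
    qed
    let ?\<theta> = "gamma_strategy WL WR \<gamma>"
    \<comment> \<open>This one strategy bounds the supremum from below, and 1 bounds it from
      above.\<close>
    have "(\<lambda>n. ?p n ?\<theta>) \<longlonglongrightarrow> 1"
      using strong[OF \<gamma>(1)] meas[OF adm] \<epsilon> unfolding \<gamma>(2)
      by (intro prob_near_limit_tendsto_1) auto
    then show ?thesis
    proof (rule tendsto_sandwich[rotated 2])
      show "\<forall>\<^sub>F n in sequentially. ?p n ?\<theta> \<le> (SUP \<theta>\<in>?\<Theta>. ?p n \<theta>)"
        by (intro always_eventually allI cSUP_upper adm) (auto intro!: bdd_aboveI[of _ 1])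
      show "\<forall>\<^sub>F n in sequentially. (SUP \<theta>\<in>?\<Theta>. ?p n \<theta>) \<le> 1"
        using adm by (intro always_eventually allI cSUP_least) auto
    qed simp
  qed
  show ?thesis
    using adm strong inf sup by blast
qed

end
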